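(* Let $a,b\in\mathbb{R}\setminus\{0\}$ with $a\neq b$ and either $a,b>0$ or $a>0>b$. Let $\mathcal{C}\subset\mathbb{CP}^2$ be the complex conic with affine equation $\frac{x^2}{a}+\frac{y^2}{b}=1$ (a complexified ellipse, respectively hyperbola), and for $\lambda\in\mathbb{C}\setminus\{a,b\}$ let $\mathcal{C}_\lambda$ be the confocal conic with affine equation $\frac{x^2}{a-\lambda}+\frac{y^2}{b-\lambda}=1$. Then exactly two of the conics $\mathcal{C}_\lambda$ are $3$-caustics of $\mathcal{C}$, and both are complexified conics of the same type as $\mathcal{C}$: both are complexified ellipses if $\mathcal{C}$ is a complexified ellipse, and both are complexified hyperbolas if $\mathcal{C}$ is a complexified hyperbola.
   Context: A complex conic is called a complexified ellipse (resp. hyperbola) if it is the complexification of a real conic whose real points form an ellipse (resp. a hyperbola). Use homogeneous coordinates $(x:y:z)$ on $\mathbb{CP}^2$, identify $\mathbb{C}^2$ with $\{z=1\}$, and equip $\mathbb{C}^2$ with the complex quadratic form $q(x,y)=x^2+y^2$. Let $I=(1:i:0)$, $J=(1:-i:0)$. A line is isotropic if it contains $I$ or $J$. If $L$ is a non-isotropic line, the symmetry with respect to $L$ is the unique non-trivial complex affine involution of $\mathbb{C}^2$ preserving $q$ and fixing the points of $L$; it extends to $\mathbb{CP}^2$ and acts on lines. If $L$ is isotropic and different from the line at infinity, and $p\in L$, two lines $\ell,\ell'$ through $p$ are symmetric with respect to $L$ if $(\ell,\ell',L,p)$ is a limit of $(\ell_n,\ell_n',L_n,p_n)$ with $\ell_n,\ell'_n,L_n$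 lines through $p_n$, $L_n$ non-isotropic and $\ell_n,\ell_n'$ symmetric with respect to $L_n$. A non-degenerate $3$-periodic orbit on a conic $C$ is a triple $(p_1,p_2,p_3)\in C^3$ (indices modulo $3$) such that for every $j$: $p_j\neq p_{j+1}$, the tangent line $T_{p_j}C$ is non-isotropic, and the lines $p_{j-1}p_j$ and $p_jp_{j+1}$ are symmetric with respect to $T_{p_j}C$. It is circumscribed about a conic $C'$ if for every $j$ the two tangent lines to $C'$ through $p_j$ are $p_{j-1}p_j$ and $p_jp_{j+1}$. A conic $C'$ is a complex caustic of $C$ if for every line $\ell$ tangent to $C'$ and every $p\in\ell\cap C$, $\ell$ is reflected into a line tangent to $C'$, i.e. a line through $p$ symmetric to $\ell$ with respect to $T_pC$ is tangent to $C'$. Two conics are in general position if they intersect in four distinct points. If $C,C'$ are in general position, $C'$ is a $3$-caustic of $C$ if $C'$ is a complex caustic of $C$ and some (non-degenerate) $3$-periodic orbit of $C$ is circumscribed about $C'$. *)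

theory Defs
  imports "HOL-Analysis.Analysis"
begin

definition pairing :: "complex^3 \<Rightarrow> complex^3 \<Rightarrow> complex" where
  "pairing u v = (\<Sum>i\<in>UNIV. u $ i * v $ i)"

definition proj_rel :: "complex^3 \<Rightarrow> complex^3 \<Rightarrow> bool" where
  "proj_rel u v \<longleftrightarrow> u \<noteq> 0 \<and> v \<noteq> 0 \<and> (\<exists>c. c \<noteq> 0 \<and> v = c *s u)"

lemma part_equivp_proj_rel: "part_equivp proj_rel"
proof (rule part_equivpI)
  show "\<exists>x. proj_rel x x"
    by (rule exI[of _ "axis 1 1"]) (auto simp: proj_rel_def axis_eq_0_iff intro: exI[of _ 1])
  show "symp proj_rel"
  proof (rule sympI)
    fix u v assume "proj_rel u v"
    then obtain c where c: "c \<noteq> 0" "v = c *s u" "u \<noteq> 0" "v \<noteq> 0"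
      by (auto simp: proj_rel_def)
    then have "u = inverse c *s v"
      by (simp add: vector_smult_assoc)
    with c show "proj_rel v u"
      unfolding proj_rel_def by (metis inverse_nonzero_iff_nonzero)
  qed
  show "transp proj_rel"
  proof (rule transpI)
    fix u v w assume "proj_rel u v" "proj_rel v w"
    then obtain c d where "c \<noteq> 0" "v = c *s u" "u \<noteq> 0" "d \<noteq> 0" "w = d *s v" "w \<noteq> 0"
      by (auto simp: proj_rel_def)
    then show "proj_rel u w"
      unfolding proj_rel_def by (auto simp: vector_smult_assoc intro!: exI[of _ "d * c"])
  qed
qed

quotient_type cp2 = "complex^3" / partial: proj_rel
  by (rule part_equivp_proj_rel)

text \<open>The line \<open>ux + vy + wz = 0\<close> is represented by its coordinates \<open>(u:v:w)\<close>, a point of the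
  dual plane; this also gives the space of lines its topology.\<close>

type_synonym cline = cp2

lift_definition incident :: "cp2 \<Rightarrow> cline \<Rightarrow> bool" is "\<lambda>v l. pairing v l = 0"
  by (auto simp: proj_rel_def pairing_def sum_distrib_left[symmetric] algebra_simps)

definition line_points :: "cline \<Rightarrow> cp2 set" where
  "line_points l = {p. incident p l}"

text \<open>Quotient topology of \<open>\<complex>\<^sup>3 - {0}\<close>.\<close>

instantiation cp2 :: topological_space
begin

definition open_cp2 :: "cp2 set \<Rightarrow> bool" where
  "open_cp2 U \<longleftrightarrow> open {v. v \<noteq> 0 \<and> abs_cp2 v \<in> U}"

instance
proof
  have "{v :: complex^3. v \<noteq> 0 \<and> abs_cp2 v \<in> UNIV} = - {0}"
    by auto
  then show "open (UNIV :: cp2 set)"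
    by (simp add: open_cp2_def open_Compl)
next
  fix S T :: "cp2 set"
  assume "open S" "open T"
  moreover have "{v. v \<noteq> 0 \<and> abs_cp2 v \<in> S \<inter> T} =
      {v. v \<noteq> 0 \<and> abs_cp2 v \<in> S} \<inter> {v. v \<noteq> 0 \<and> abs_cp2 v \<in> T}"
    by auto
  ultimately show "open (S \<inter> T)"
    unfolding open_cp2_def by (simp add: open_Int)
next
  fix K :: "cp2 set set"
  assume "\<forall>S\<in>K. open S"
  moreover have "{v. v \<noteq> 0 \<and> abs_cp2 v \<in> \<Union>K} = (\<Union>S\<in>K. {v. v \<noteq> 0 \<and> abs_cp2 v \<in> S})"
    by auto
  ultimately show "open (\<Union>K)"
    unfolding open_cp2_def by auto
qed

end

definition join :: "cp2 \<Rightarrow> cp2 \<Rightarrow> cline" where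
  "join p r = (THE l. incident p l \<and> incident r l)"

definition embed_affine :: "complex^2 \<Rightarrow> cp2" where
  "embed_affine v = abs_cp2 (vector [v $ 1, v $ 2, 1])"

definition line_at_infinity :: cline where
  "line_at_infinity = abs_cp2 (vector [0, 0, 1])"

text \<open>A smooth conic is a non-degenerate quadratic form, given by its symmetric matrix, up to a
  scalar factor.\<close>

definition conic_rel :: "complex^3^3 \<Rightarrow> complex^3^3 \<Rightarrow> bool" where
  "conic_rel M N \<longleftrightarrow> transpose M = M \<and> transpose N = N \<and> det M \<noteq> 0 \<and> det N \<noteq> 0 \<and>
     (\<exists>c. c \<noteq> 0 \<and> (\<forall>i j. N $ i $ j = c * M $ i $ j))"

lemma part_equivp_conic_rel: "part_equivp conic_rel"
proof (rule part_equivpI)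
  show "\<exists>x. conic_rel x x"
    by (rule exI[of _ "mat 1"]) (auto simp: conic_rel_def transpose_mat intro: exI[of _ 1])
  show "symp conic_rel"
  proof (rule sympI)
    fix M N assume MN: "conic_rel M N"
    then obtain c where c: "c \<noteq> 0" "\<forall>i j. N $ i $ j = c * M $ i $ j"
      by (auto simp: conic_rel_def)
    then have "inverse c \<noteq> 0 \<and> (\<forall>i j. M $ i $ j = inverse c * N $ i $ j)"
      by (simp add: field_simps)
    with MN show "conic_rel N M"
      unfolding conic_rel_def by blast
  qed
  show "transp conic_rel"
  proof (rule transpI)
    fix M N P assume MN: "conic_rel M N" and NP: "conic_rel N P"
    from MN obtain c where c: "c \<noteq> 0" "\<forall>i j. N $ i $ j = c * M $ i $ j"
      by (auto simp: conic_rel_def)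
    from NP obtain d where d: "d \<noteq> 0" "\<forall>i j. P $ i $ j = d * N $ i $ j"
      by (auto simp: conic_rel_def)
    from c d have "d * c \<noteq> 0 \<and> (\<forall>i j. P $ i $ j = (d * c) * M $ i $ j)"
      by simp
    with MN NP show "conic_rel M P"
      unfolding conic_rel_def by blast
  qed
qed

quotient_type conic = "complex^3^3" / partial: conic_rel
  by (rule part_equivp_conic_rel)

lemma conic_rel_mult_vec:
  assumes "\<forall>i j. N $ i $ j = c * (M :: complex^3^3) $ i $ j"
  shows "N *v (d *s v) = (c * d) *s (M *v v)"
  using assms by (simp add: vec_eq_iff matrix_vector_mult_def sum_distrib_left algebra_simps)

lift_definition on_conic :: "conic \<Rightarrow> cp2 \<Rightarrow> bool" is "\<lambda>M v. pairing v (M *v v) = 0"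
proof -
  fix M N :: "complex^3^3" and v w :: "complex^3"
  assume "conic_rel M N" "proj_rel v w"
  then obtain c d where cd: "c \<noteq> 0" "\<forall>i j. N $ i $ j = c * M $ i $ j" "d \<noteq> 0" "w = d *s v"
    by (auto simp: conic_rel_def proj_rel_def)
  have "pairing w (N *v w) = (d * (c * d)) * pairing v (M *v v)"
    unfolding cd(4) conic_rel_mult_vec[OF cd(2)]
    by (simp add: pairing_def sum_distrib_left algebra_simps)
  with cd show "(pairing v (M *v v) = 0) = (pairing w (N *v w) = 0)"
    by simp
qed

definition conic_points :: "conic \<Rightarrow> cp2 set" where
  "conic_points C = {p. on_conic C p}"

text \<open>The coordinates of the tangent line at \<open>p\<close> are the gradient of the quadratic form at
  \<open>p\<close>, up to the factor \<open>2\<close>. This is used only for \<open>p\<close> on the conic.\<close>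

lift_definition tangent_line :: "conic \<Rightarrow> cp2 \<Rightarrow> cline" is "\<lambda>M v. M *v v"
proof -
  fix M N :: "complex^3^3" and v w :: "complex^3"
  assume MN: "conic_rel M N" and vw: "proj_rel v w"
  then obtain c d where cd: "c \<noteq> 0" "\<forall>i j. N $ i $ j = c * M $ i $ j" "d \<noteq> 0" "w = d *s v"
    by (auto simp: conic_rel_def proj_rel_def)
  have nz: "A *v x \<noteq> 0" if "det A \<noteq> 0" "x \<noteq> 0" for A :: "complex^3^3" and x
    using that by (metis invertible_det_nz invertible_def matrix_vector_mul_assoc
        matrix_vector_mul_lid matrix_vector_mult_0_right)
  have "N *v w = (c * d) *s (M *v v)"
    unfolding cd(4) by (rule conic_rel_mult_vec[OF cd(2)])
  moreover have "M *v v \<noteq> 0" "N *v w \<noteq> 0"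
    using nz MN vw by (auto simp: conic_rel_def proj_rel_def)
  ultimately show "proj_rel (M *v v) (N *v w)"
    unfolding proj_rel_def using cd by (metis mult_eq_0_iff)
qed

definition tangent_to :: "cline \<Rightarrow> conic \<Rightarrow> bool" where
  "tangent_to l C \<longleftrightarrow> (\<exists>p\<in>conic_points C. l = tangent_line C p)"

text \<open>The conic with affine equation \<open>x\<^sup>2/A + y\<^sup>2/B = 1\<close>, for non-zero \<open>A\<close> and \<open>B\<close>.\<close>

definition central_conic :: "complex \<Rightarrow> complex \<Rightarrow> conic" where
  "central_conic A B =
     abs_conic (vector [vector [1 / A, 0, 0], vector [0, 1 / B, 0], vector [0, 0, -1]])"

definition confocal_conic :: "real \<Rightarrow> real \<Rightarrow> complex \<Rightarrow> conic" where
  "confocal_conic a b \<mu> = central_conic (of_real a - \<mu>) (of_real b - \<mu>)"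

definition is_ellipse :: "(real^2) set \<Rightarrow> bool" where
  "is_ellipse S \<longleftrightarrow> (\<exists>c u v \<alpha> \<beta>. norm u = 1 \<and> norm v = 1 \<and> u \<bullet> v = 0 \<and> \<alpha> > 0 \<and> \<beta> > 0 \<and>
     S = {P. ((P - c) \<bullet> u)\<^sup>2 / \<alpha>\<^sup>2 + ((P - c) \<bullet> v)\<^sup>2 / \<beta>\<^sup>2 = 1})"

definition is_hyperbola :: "(real^2) set \<Rightarrow> bool" where
  "is_hyperbola S \<longleftrightarrow> (\<exists>c u v \<alpha> \<beta>. norm u = 1 \<and> norm v = 1 \<and> u \<bullet> v = 0 \<and> \<alpha> > 0 \<and> \<beta> > 0 \<and>
     S = {P. ((P - c) \<bullet> u)\<^sup>2 / \<alpha>\<^sup>2 - ((P - c) \<bullet> v)\<^sup>2 / \<beta>\<^sup>2 = 1})"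

definition real_conic_points :: "real^3^3 \<Rightarrow> (real^2) set" where
  "real_conic_points R = {P. let v = vector [P $ 1, P $ 2, 1] in v \<bullet> (R *v v) = 0}"

definition complexification :: "real^3^3 \<Rightarrow> conic" where
  "complexification R = abs_conic (\<chi> i j. complex_of_real (R $ i $ j))"

definition complexified_ellipse :: "conic \<Rightarrow> bool" where
  "complexified_ellipse C \<longleftrightarrow> (\<exists>R. transpose R = R \<and> det R \<noteq> 0 \<and>
     is_ellipse (real_conic_points R) \<and> C = complexification R)"

definition complexified_hyperbola :: "conic \<Rightarrow> bool" where
  "complexified_hyperbola C \<longleftrightarrow> (\<exists>R. transpose R = R \<and> det R \<noteq> 0 \<and>
     is_hyperbola (real_conic_points R) \<and> C = complexification R)"

definition isotropic :: "cline \<Rightarrow> bool" where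
  "isotropic L \<longleftrightarrow> incident (abs_cp2 (vector [1, \<i>, 0])) L \<or> incident (abs_cp2 (vector [1, -\<i>, 0])) L"

definition qform :: "complex^2 \<Rightarrow> complex" where
  "qform v = (v $ 1)\<^sup>2 + (v $ 2)\<^sup>2"

text \<open>The affine map \<open>v \<mapsto> A v + t\<close> is the symmetry with respect to \<open>L\<close>; for non-isotropic \<open>L\<close>
  there is exactly one such pair \<open>(A, t)\<close>.\<close>

definition is_symmetry :: "cline \<Rightarrow> complex^2^2 \<Rightarrow> complex^2 \<Rightarrow> bool" where
  "is_symmetry L A t \<longleftrightarrow>
     (let \<sigma> = (\<lambda>v. A *v v + t) in
        \<sigma> \<circ> \<sigma> = id \<and> \<sigma> \<noteq> id \<and> (\<forall>v. qform (A *v v) = qform v) \<and>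
        (\<forall>v. incident (embed_affine v) L \<longrightarrow> \<sigma> v = v))"

text \<open>The extension \<open>(x:y:z) \<mapsto> (A (x,y) + z t : z)\<close> to the projective plane, well defined
  for invertible \<open>A\<close>.\<close>

definition projective_extension :: "complex^2^2 \<Rightarrow> complex^2 \<Rightarrow> cp2 \<Rightarrow> cp2" where
  "projective_extension A t p =
     abs_cp2 (vector [vector [A $ 1 $ 1, A $ 1 $ 2, t $ 1],
                      vector [A $ 2 $ 1, A $ 2 $ 2, t $ 2],
                      vector [0, 0, 1]] *v rep_cp2 p)"

definition symmetric_nonisotropic :: "cline \<Rightarrow> cline \<Rightarrow> cline \<Rightarrow> bool" where
  "symmetric_nonisotropic L l l' \<longleftrightarrow> \<not> isotropic L \<and>
     (\<exists>A t. is_symmetry L A t \<and> line_points l' = projective_extension A t ` line_points l)"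

text \<open>The lines \<open>l\<close> and \<open>l'\<close> through the point \<open>p\<close> of \<open>L\<close> are symmetric with respect to \<open>L\<close>.
  No lines are symmetric with respect to the line at infinity.\<close>

definition symmetric_lines :: "cp2 \<Rightarrow> cline \<Rightarrow> cline \<Rightarrow> cline \<Rightarrow> bool" where
  "symmetric_lines p L l l' \<longleftrightarrow> incident p L \<and> incident p l \<and> incident p l' \<and>
     (if isotropic L then
        L \<noteq> line_at_infinity \<and>
        (\<exists>ln ln' Ln pn.
           (\<forall>n::nat. incident (pn n) (ln n) \<and> incident (pn n) (ln' n) \<and> incident (pn n) (Ln n) \<and>
              symmetric_nonisotropic (Ln n) (ln n) (ln' n)) \<and>
           (\<lambda>n. (ln n, ln' n, Ln n, pn n)) \<longlonglongrightarrow> (l, l', L, p))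
      else symmetric_nonisotropic L l l')"

text \<open>Triples are indexed by the type \<open>3\<close>, whose arithmetic is modulo \<open>3\<close>.\<close>

definition periodic_orbit_3 :: "conic \<Rightarrow> (3 \<Rightarrow> cp2) \<Rightarrow> bool" where
  "periodic_orbit_3 C p \<longleftrightarrow> (\<forall>j. p j \<in> conic_points C \<and> p j \<noteq> p (j + 1) \<and>
     \<not> isotropic (tangent_line C (p j)) \<and>
     symmetric_lines (p j) (tangent_line C (p j)) (join (p (j - 1)) (p j)) (join (p j) (p (j + 1))))"

definition circumscribed_about :: "(3 \<Rightarrow> cp2) \<Rightarrow> conic \<Rightarrow> bool" where
  "circumscribed_about p C' \<longleftrightarrow> (\<forall>j. {l. tangent_to l C' \<and> incident (p j) l} =
     {join (p (j - 1)) (p j), join (p j) (p (j + 1))})"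

definition complex_caustic :: "conic \<Rightarrow> conic \<Rightarrow> bool" where
  "complex_caustic C C' \<longleftrightarrow> (\<forall>l. tangent_to l C' \<longrightarrow> (\<forall>p \<in> line_points l \<inter> conic_points C.
     \<exists>l'. symmetric_lines p (tangent_line C p) l l' \<and> tangent_to l' C'))"

definition general_position :: "conic \<Rightarrow> conic \<Rightarrow> bool" where
  "general_position C C' \<longleftrightarrow> card (conic_points C \<inter> conic_points C') = 4"

definition caustic_3 :: "conic \<Rightarrow> conic \<Rightarrow> bool" where
  "caustic_3 C C' \<longleftrightarrow> general_position C C' \<and> complex_caustic C C' \<and>
     (\<exists>p. periodic_orbit_3 C p \<and> circumscribed_about p C')"

definition confocal_3_caustics :: "real \<Rightarrow> real \<Rightarrow> conic set" where
  "confocal_3_caustics a b =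
     {confocal_conic a b \<mu> | \<mu>. \<mu> \<notin> {of_real a, of_real b} \<and>
        caustic_3 (central_conic (of_real a) (of_real b)) (confocal_conic a b \<mu>)}"

end

theory Submission
  imports Defs
begin

text \<open>
  In line coordinates \<open>m\<close> the tangents of \<open>\<C>\<^sub>\<lambda>\<close> form the dual conic
  \<open>(a - \<lambda>) m\<^sub>1\<^sup>2 + (b - \<lambda>) m\<^sub>2\<^sup>2 = m\<^sub>3\<^sup>2\<close>, and the symmetry with respect to a non-isotropic line \<open>l\<close> acts as
  the reflection \<open>m \<mapsto> m - 2 n(l, m) / n(l, l) l\<close>, where \<open>n(l, m) = l\<^sub>1 m\<^sub>1 + l\<^sub>2 m\<^sub>2\<close>. The dual forms of
  confocal conics differ by multiples of \<open>n\<close>. If \<open>l\<close> is the tangent of \<open>\<C>\<close> at \<open>p\<close>, then on the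
  lines through \<open>p\<close> the dual form of \<open>\<C>\<close> does not change along \<open>l\<close>, so there the reflection
  preserves the dual form of every \<open>\<C>\<^sub>\<lambda>\<close> (\<open>confocal_form_reflect\<close>). Hence every \<open>\<C>\<^sub>\<lambda>\<close> is a complex caustic
  (\<open>confocal_complex_caustic\<close>), isotropic tangents being dealt with by a limit; and if \<open>\<lambda> \<noteq> 0\<close> and \<open>l\<close>
  is non-isotropic, the tangents of \<open>\<C>\<^sub>\<lambda>\<close> through \<open>p\<close> are any one of them and its reflection
  (\<open>tangents_through_conic_point\<close>). So, for \<open>\<lambda> \<noteq> 0\<close>, \<open>\<C>\<^sub>\<lambda>\<close> is a \<open>3\<close>-caustic as soon as some
  triangle with non-isotropic tangents at its vertices is inscribed in \<open>\<C>\<close> and circumscribed about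
  \<open>\<C>\<^sub>\<lambda>\<close>.

  In the projective frame given by such a triangle, the matrix \<open>M\<close> of \<open>\<C>\<close> and the dual matrix \<open>N\<close> of \<open>\<C>\<^sub>\<lambda>\<close>
  have zero diagonals, which implies \<open>2 tr ((M N)\<^sup>2) = (tr (M N))\<^sup>2\<close>. As \<open>M N\<close> is similar to the
  diagonal matrix with entries \<open>(a - \<lambda>) / a\<close>, \<open>(b - \<lambda>) / b\<close>, \<open>1\<close>, this is a quadratic equation for \<open>\<lambda>\<close>,
  \<open>(a - b)\<^sup>2 \<lambda>\<^sup>2 + 2 a b (a + b) \<lambda> = 3 a\<^sup>2 b\<^sup>2\<close> (\<open>circumscribed_orbit_condition\<close>).
  Conversely, each root yields a triangle that is symmetric about an axis (\<open>isosceles_orbit\<close>).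

  The difference of the two sides of the equation is negative at \<open>0\<close> and takes the values \<open>a\<^sup>4\<close> and \<open>b\<^sup>4\<close> at \<open>a\<close>
  and \<open>b\<close>. So there are two real roots, one on each side of \<open>0\<close>, and neither \<open>a\<close> nor \<open>b\<close> lies between them;
  therefore \<open>a - \<lambda>\<close> and \<open>b - \<lambda>\<close> have the signs of \<open>a\<close> and \<open>b\<close>. The two types exclude each other because an
  ellipse is bounded and a hyperbola is not.\<close>

section \<open>Points and lines of the projective plane\<close>

lemma vec3_eq_iff: "(u::'a^3) = v \<longleftrightarrow> u$1 = v$1 \<and> u$2 = v$2 \<and> u$3 = v$3"
  by (simp add: vec_eq_iff forall_3)

lemma pairing_3: "pairing u v = u$1 * v$1 + u$2 * v$2 + u$3 * v$3"
  by (simp add: pairing_def sum_3)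

lemma proj_rel_refl: "proj_rel v v \<longleftrightarrow> v \<noteq> 0"
  by (auto simp: proj_rel_def intro: exI[of _ 1])

lemma cp2_cases:
  obtains v where "v \<noteq> 0" "p = abs_cp2 v"
  by (metis Quotient_cp2 Quotient_abs_rep Quotient_rep_reflp proj_rel_refl)

lemma abs_cp2_eq_iff:
  assumes "u \<noteq> 0" "v \<noteq> 0"
  shows "abs_cp2 u = abs_cp2 v \<longleftrightarrow> (\<exists>c. c \<noteq> 0 \<and> v = c *s u)"
proof -
  have "proj_rel u v \<longleftrightarrow> abs_cp2 u = abs_cp2 v"
    using Quotient_rel[OF Quotient_cp2, of u v] assms by (simp add: proj_rel_refl)
  then show ?thesis using assms by (auto simp: proj_rel_def)
qed

lemma abs_cp2_scale:
  assumes "v \<noteq> 0" "c \<noteq> 0"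
  shows "abs_cp2 (c *s v) = abs_cp2 v"
proof -
  have "c *s v \<noteq> 0" using assms by simp
  then show ?thesis using assms abs_cp2_eq_iff[of v "c *s v"] by metis
qed

lemma rep_cp2_abs_obtain:
  assumes "v \<noteq> 0"
  obtains c where "c \<noteq> 0" "rep_cp2 (abs_cp2 v) = c *s v"
proof -
  have "proj_rel v (rep_cp2 (abs_cp2 v))"
    using Quotient_rep_abs[OF Quotient_cp2, of v] assms
    by (metis proj_rel_refl part_equivp_symp part_equivp_proj_rel)
  then show thesis using that by (auto simp: proj_rel_def)
qed

lemma incident_abs:
  assumes "u \<noteq> 0" "v \<noteq> 0"
  shows "incident (abs_cp2 u) (abs_cp2 v) \<longleftrightarrow> pairing u v = 0"
  using assms by (simp add: incident.abs_eq proj_rel_refl)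

definition cross :: "complex^3 \<Rightarrow> complex^3 \<Rightarrow> complex^3" where
  "cross u v = vector [u$2 * v$3 - u$3 * v$2, u$3 * v$1 - u$1 * v$3, u$1 * v$2 - u$2 * v$1]"

lemma cross_eq_0_iff:
  assumes "u \<noteq> 0" "v \<noteq> 0"
  shows "cross u v = 0 \<longleftrightarrow> abs_cp2 u = abs_cp2 v"
proof
  assume "abs_cp2 u = abs_cp2 v"
  then show "cross u v = 0"
    using assms by (auto simp: abs_cp2_eq_iff vec3_eq_iff cross_def)
next
  assume *: "cross u v = 0"
  obtain i where i: "u$i \<noteq> 0" using assms(1) by (auto simp: vec_eq_iff)
  have minors: "u$j * v$k = u$k * v$j" for j k
    using * exhaust_3[of j] exhaust_3[of k] by (auto simp: vec3_eq_iff cross_def)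
  have "v = (v$i / u$i) *s u"
    using i minors[of i] by (simp add: vec_eq_iff field_simps)
  moreover from this have "v$i / u$i \<noteq> 0"
    using assms(2) by auto
  ultimately show "abs_cp2 u = abs_cp2 v"
    using abs_cp2_eq_iff[OF assms] by blast
qed

lemma cross_orthogonal: "pairing u (cross u v) = 0" "pairing v (cross u v) = 0"
  by (simp_all add: pairing_3 cross_def algebra_simps)

text \<open>The line through two points has the cross product of their coordinate vectors as coordinates;
  every vector orthogonal to both of them is parallel to it. Since points and lines are represented
  alike, the same statement says where two lines meet.\<close>

lemma line_through_two_points:
  assumes "u \<noteq> 0" "v \<noteq> 0" "l \<noteq> 0" "abs_cp2 u \<noteq> abs_cp2 v"
    and "pairing u l = 0" "pairing v l = 0"
  shows "abs_cp2 l = abs_cp2 (cross u v)"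
proof -
  have "cross l (cross u v) = 0"
    using assms(5,6) unfolding pairing_3 cross_def vec3_eq_iff vector_3 zero_index
    by algebra
  then show ?thesis
    using assms cross_eq_0_iff by blast
qed

lemma join_eqI:
  assumes "p \<noteq> r" "incident p l" "incident r l"
  shows "join p r = l"
proof -
  obtain u v where uv: "u \<noteq> 0" "p = abs_cp2 u" "v \<noteq> 0" "r = abs_cp2 v"
    by (metis cp2_cases)
  have "k = abs_cp2 (cross u v)" if "incident p k" "incident r k" for k
    using that assms(1) uv
    by (metis cp2_cases incident_abs line_through_two_points)
  then show ?thesis
    unfolding join_def using assms(2,3) by (intro the_equality) auto
qed

lemma isotropic_abs:
  assumes "l \<noteq> 0"
  shows "isotropic (abs_cp2 l) \<longleftrightarrow> (l$1)\<^sup>2 + (l$2)\<^sup>2 = 0"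
proof -
  have "(l$1)\<^sup>2 + (l$2)\<^sup>2 = (l$1 + \<i> * l$2) * (l$1 - \<i> * l$2)"
    by (simp add: power2_eq_square algebra_simps)
  moreover have "vector [1, \<i>, 0] \<noteq> (0::complex^3)" "vector [1, -\<i>, 0] \<noteq> (0::complex^3)"
    by (simp_all add: vec3_eq_iff)
  ultimately show ?thesis
    unfolding isotropic_def using assms by (simp add: incident_abs pairing_3)
qed

section \<open>Central conics\<close>

definition central_gradient :: "complex \<Rightarrow> complex \<Rightarrow> complex^3 \<Rightarrow> complex^3" where
  "central_gradient A B v = vector [v$1 / A, v$2 / B, - v$3]"

lemma conic_rel_central:
  assumes "A \<noteq> 0" "B \<noteq> 0"
  defines "M \<equiv> (vector [vector [1 / A, 0, 0], vector [0, 1 / B, 0], vector [0, 0, -1]]) :: complex^3^3"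
  shows "conic_rel M M"
  using assms by (auto simp: conic_rel_def det_3 transpose_def vec_eq_iff forall_3 intro: exI[of _ 1])

lemma central_matrix_vec:
  "(vector [vector [1 / A, 0, 0], vector [0, 1 / B, 0], vector [0, 0, -1]]) *v (v :: complex^3) =
    central_gradient A B v"
  by (simp add: central_gradient_def vec3_eq_iff matrix_vector_mult_def sum_3)

lemma central_conic_points_abs:
  assumes "A \<noteq> 0" "B \<noteq> 0" "v \<noteq> 0"
  shows "abs_cp2 v \<in> conic_points (central_conic A B) \<longleftrightarrow> (v$1)\<^sup>2 / A + (v$2)\<^sup>2 / B = (v$3)\<^sup>2"
  using assms conic_rel_central[OF assms(1,2)]
  by (simp add: conic_points_def central_conic_def on_conic.abs_eq proj_rel_refl
      central_matrix_vec central_gradient_def pairing_3 power2_eq_square)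

lemma tangent_line_central:
  assumes "A \<noteq> 0" "B \<noteq> 0" "v \<noteq> 0"
  shows "tangent_line (central_conic A B) (abs_cp2 v) = abs_cp2 (central_gradient A B v)"
  using assms conic_rel_central[OF assms(1,2)]
  by (simp add: central_conic_def tangent_line.abs_eq proj_rel_refl central_matrix_vec)

lemma central_gradient_nonzero:
  assumes "A \<noteq> 0" "B \<noteq> 0" "v \<noteq> 0"
  shows "central_gradient A B v \<noteq> 0"
  using assms by (auto simp: central_gradient_def vec3_eq_iff)

text \<open>The dual conic: \<open>l\<close> is tangent exactly when its pole \<open>(A l\<^sub>1 : B l\<^sub>2 : - l\<^sub>3)\<close> lies on the
  conic, because the gradient map takes the pole back to \<open>l\<close>.\<close>

lemma tangent_to_central:
  assumes "A \<noteq> 0" "B \<noteq> 0" "l \<noteq> 0"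
  shows "tangent_to (abs_cp2 l) (central_conic A B) \<longleftrightarrow> A * (l$1)\<^sup>2 + B * (l$2)\<^sup>2 = (l$3)\<^sup>2"
proof
  assume "tangent_to (abs_cp2 l) (central_conic A B)"
  then obtain p where p: "p \<in> conic_points (central_conic A B)"
      "abs_cp2 l = tangent_line (central_conic A B) p"
    by (auto simp: tangent_to_def)
  obtain v where v: "v \<noteq> 0" "p = abs_cp2 v" by (rule cp2_cases)
  from p v obtain c where c: "c \<noteq> 0" "central_gradient A B v = c *s l"
    using abs_cp2_eq_iff[OF assms(3) central_gradient_nonzero[OF assms(1,2) v(1)]]
    by (auto simp: tangent_line_central[OF assms(1,2)])
  have e: "v$1 = A * c * l$1" "v$2 = B * c * l$2" "v$3 = - c * l$3"
    using c(2) assms(1,2) by (auto simp: central_gradient_def vec3_eq_iff field_simps) (metis add.inverse_inverse)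
  have "(v$1)\<^sup>2 / A + (v$2)\<^sup>2 / B = (v$3)\<^sup>2"
    using p(1) v central_conic_points_abs[OF assms(1,2) v(1)] by simp
  then have "c\<^sup>2 * (A * (l$1)\<^sup>2 + B * (l$2)\<^sup>2) = c\<^sup>2 * (l$3)\<^sup>2"
    unfolding e using assms(1,2) by (simp add: field_simps power2_eq_square)
  then show "A * (l$1)\<^sup>2 + B * (l$2)\<^sup>2 = (l$3)\<^sup>2" using c(1) by simp
next
  assume *: "A * (l$1)\<^sup>2 + B * (l$2)\<^sup>2 = (l$3)\<^sup>2"
  define v :: "complex^3" where "v = vector [A * l$1, B * l$2, - l$3]"
  have v: "v \<noteq> 0" using assms by (auto simp: v_def vec3_eq_iff)
  have "central_gradient A B v = l"
    using assms by (simp add: v_def central_gradient_def vec3_eq_iff)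
  then have "tangent_line (central_conic A B) (abs_cp2 v) = abs_cp2 l"
    using tangent_line_central[OF assms(1,2) v] by simp
  moreover have "abs_cp2 v \<in> conic_points (central_conic A B)"
    unfolding central_conic_points_abs[OF assms(1,2) v]
    using * assms by (simp add: v_def power2_eq_square ac_simps)
  ultimately show "tangent_to (abs_cp2 l) (central_conic A B)"
    unfolding tangent_to_def by metis
qed

section \<open>Symmetries with respect to lines\<close>

text \<open>The form on line coordinates whose isotropic vectors are the isotropic lines: the bilinear form
  of \<open>q\<close> on normal vectors, which does not see the constant term of a line.\<close>

definition nform :: "complex^3 \<Rightarrow> complex^3 \<Rightarrow> complex" where
  "nform l m = l$1 * m$1 + l$2 * m$2"

text \<open>With \<open>l\<close> non-isotropic, the symmetry with respect to \<open>l\<close> is the affine reflection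
  \<open>X \<mapsto> X - 2 l(X) n / n\<^sup>2\<close> with normal vector \<open>n = (l\<^sub>1, l\<^sub>2)\<close>. It is linear in homogeneous
  coordinates, and its transpose acts on line coordinates as a reflection along \<open>l\<close> itself, which
  is what makes the action on dual conics easy to compute.\<close>

definition reflect_line :: "complex^3 \<Rightarrow> complex^3 \<Rightarrow> complex^3" where
  "reflect_line l m = m - (2 * nform l m / nform l l) *s l"

definition reflect_point :: "complex^3 \<Rightarrow> complex^3 \<Rightarrow> complex^3" where
  "reflect_point l v = v - (2 * pairing v l / nform l l) *s vector [l$1, l$2, 0]"

lemma isotropic_nform: "l \<noteq> 0 \<Longrightarrow> isotropic (abs_cp2 l) \<longleftrightarrow> nform l l = 0"
  by (simp add: isotropic_abs nform_def power2_eq_square)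

lemma reflect_line_involution:
  assumes "nform l l \<noteq> 0"
  shows "reflect_line l (reflect_line l m) = m"
proof -
  have "nform l (m - c *s l) = nform l m - c * nform l l" for c
    by (simp add: nform_def algebra_simps)
  then have "nform l (reflect_line l m) = - nform l m"
    using assms by (simp add: reflect_line_def)
  then show ?thesis by (simp add: reflect_line_def)
qed

lemma reflect_point_involution:
  assumes "nform l l \<noteq> 0"
  shows "reflect_point l (reflect_point l v) = v"
proof -
  have "pairing (v - c *s vector [l$1, l$2, 0]) l = pairing v l - c * nform l l" for c
    by (simp add: nform_def pairing_3 algebra_simps)
  then have "pairing (reflect_point l v) l = - pairing v l"
    using assms by (simp add: reflect_point_def)
  then show ?thesis by (simp add: reflect_point_def)
qed

lemma pairing_reflect:
  "pairing (reflect_point l v) m = pairing v (reflect_line l m)"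
  by (simp add: pairing_3 reflect_point_def reflect_line_def nform_def algebra_simps
      add_divide_distrib)

lemma reflect_nonzero:
  assumes "nform l l \<noteq> 0"
  shows "m \<noteq> 0 \<Longrightarrow> reflect_line l m \<noteq> 0" "v \<noteq> 0 \<Longrightarrow> reflect_point l v \<noteq> 0"
proof -
  have "reflect_line l 0 = 0" "reflect_point l 0 = 0"
    by (simp_all add: reflect_line_def nform_def reflect_point_def pairing_3)
  then show "m \<noteq> 0 \<Longrightarrow> reflect_line l m \<noteq> 0" "v \<noteq> 0 \<Longrightarrow> reflect_point l v \<noteq> 0"
    using reflect_line_involution[OF assms, of m] reflect_point_involution[OF assms, of v] by auto
qed

lemma reflect_point_scale: "reflect_point l (c *s v) = c *s reflect_point l v"
  by (simp add: reflect_point_def pairing_3 vec3_eq_iff algebra_simps)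

text \<open>The matrix and the translation are read off from \<open>reflect_point l\<close> on points \<open>(x : y : 1)\<close>;
  all required properties then are those of a reflection in a quadratic space.\<close>

lemma symmetry_exists:
  assumes n: "nform l l \<noteq> 0"
  obtains A t where "is_symmetry (abs_cp2 l) A t"
    "\<And>v. v \<noteq> 0 \<Longrightarrow> projective_extension A t (abs_cp2 v) = abs_cp2 (reflect_point l v)"
proof -
  have l: "l \<noteq> 0" using n by (auto simp: nform_def)
  define N where "N = nform l l"
  define A :: "complex^2^2" where
    "A = vector [vector [1 - 2 * l$1 * l$1 / N, - 2 * l$1 * l$2 / N],
                 vector [- 2 * l$1 * l$2 / N, 1 - 2 * l$2 * l$2 / N]]"
  define t :: "complex^2" where "t = vector [- 2 * l$3 * l$1 / N, - 2 * l$3 * l$2 / N]"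
  define h :: "complex^2 \<Rightarrow> complex^3" where "h = (\<lambda>v. vector [v$1, v$2, 1])"
  have N: "N \<noteq> 0" "N = l$1 * l$1 + l$2 * l$2" using n by (auto simp: N_def nform_def)
  have h: "h v \<noteq> 0" "embed_affine v = abs_cp2 (h v)" for v
    by (auto simp: h_def vec3_eq_iff embed_affine_def)
  have hs: "h (A *v v + t) = reflect_point l (h v)" for v
    using N(1) by (simp add: vec3_eq_iff h_def reflect_point_def A_def t_def N_def[symmetric]
        matrix_vector_mult_def sum_2 pairing_3 field_simps)
  have h_inj: "h v = h w \<Longrightarrow> v = w" for v w
    by (auto simp: h_def vec_eq_iff forall_2 forall_3)
  let ?s = "\<lambda>v. A *v v + t"
  have "?s \<circ> ?s = id"
    using hs reflect_point_involution[OF n] by (auto intro!: h_inj)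
  moreover have "?s \<noteq> id"
  proof
    assume id: "?s = id"
    have r: "reflect_point l (h v) = h v" for v
      using hs[of v] fun_cong[OF id, of v] by simp
    have "pairing (h v) l = 0" for v
      using r[of v] N by (auto simp: reflect_point_def vec3_eq_iff N_def[symmetric])
    from this[of 0] this[of "vector [1, 0]"] this[of "vector [0, 1]"]
    show False using N by (simp add: h_def pairing_3)
  qed
  moreover have "qform (A *v v) = qform v" for v
  proof -
    define k where "k = (l$1 * v$1 + l$2 * v$2) / N"
    have "A *v v = vector [v$1 - 2 * k * l$1, v$2 - 2 * k * l$2]"
      using N(1) by (simp add: k_def A_def vec_eq_iff forall_2 matrix_vector_mult_def sum_2 field_simps)
    then have Av: "(A *v v)$1 = v$1 - 2 * k * l$1" "(A *v v)$2 = v$2 - 2 * k * l$2"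
      by simp_all
    have "l$1 * v$1 + l$2 * v$2 = k * (l$1 * l$1 + l$2 * l$2)"
      using N by (simp add: k_def)
    then show ?thesis
      unfolding qform_def Av by algebra
  qed
  moreover have "?s v = v" if "incident (embed_affine v) (abs_cp2 l)" for v
    using that h l by (intro h_inj) (simp add: hs incident_abs, simp add: reflect_point_def)
  ultimately have sym: "is_symmetry (abs_cp2 l) A t"
    by (simp add: is_symmetry_def Let_def)
  define S :: "complex^3^3" where "S = vector [vector [A $ 1 $ 1, A $ 1 $ 2, t $ 1],
                      vector [A $ 2 $ 1, A $ 2 $ 2, t $ 2], vector [0, 0, 1]]"
  have S: "S *v v = reflect_point l v" for v
    using N(1) by (simp add: S_def vec3_eq_iff h_def reflect_point_def A_def t_def N_def[symmetric]
        matrix_vector_mult_def sum_3 pairing_3 field_simps)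
  have "projective_extension A t (abs_cp2 v) = abs_cp2 (reflect_point l v)" if v: "v \<noteq> 0" for v
  proof -
    obtain c where "c \<noteq> 0" "rep_cp2 (abs_cp2 v) = c *s v"
      using rep_cp2_abs_obtain[OF v] .
    then show ?thesis
      using reflect_nonzero(2)[OF n v]
      by (simp add: projective_extension_def S_def[symmetric] S reflect_point_scale abs_cp2_scale)
  qed
  with sym show thesis by (rule that)
qed

lemma symmetric_nonisotropic_reflect:
  assumes n: "nform l l \<noteq> 0" and m: "m \<noteq> 0"
  shows "symmetric_nonisotropic (abs_cp2 l) (abs_cp2 m) (abs_cp2 (reflect_line l m))"
proof -
  have l: "l \<noteq> 0" using n by (auto simp: nform_def)
  obtain A t where At: "is_symmetry (abs_cp2 l) A t"
    "\<And>v. v \<noteq> 0 \<Longrightarrow> projective_extension A t (abs_cp2 v) = abs_cp2 (reflect_point l v)"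
    by (rule symmetry_exists[OF n]) blast
  have on: "incident (abs_cp2 (reflect_point l v)) (abs_cp2 (reflect_line l m)) \<longleftrightarrow>
      incident (abs_cp2 v) (abs_cp2 m)" if "v \<noteq> 0" for v
    using that m reflect_nonzero[OF n]
    by (simp add: incident_abs pairing_reflect reflect_line_involution[OF n])
  have "line_points (abs_cp2 (reflect_line l m)) = projective_extension A t ` line_points (abs_cp2 m)"
  proof (intro equalityI subsetI)
    fix p assume p: "p \<in> line_points (abs_cp2 (reflect_line l m))"
    obtain v where v: "v \<noteq> 0" "p = abs_cp2 v" by (rule cp2_cases)
    have "abs_cp2 (reflect_point l v) \<in> line_points (abs_cp2 m)"
      using on[of "reflect_point l v"] p v reflect_nonzero(2)[OF n v(1)]
      by (simp add: line_points_def reflect_point_involution[OF n])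
    moreover have "p = projective_extension A t (abs_cp2 (reflect_point l v))"
      using v reflect_nonzero(2)[OF n v(1)] by (simp add: At(2) reflect_point_involution[OF n])
    ultimately show "p \<in> projective_extension A t ` line_points (abs_cp2 m)" by blast
  next
    fix p assume "p \<in> projective_extension A t ` line_points (abs_cp2 m)"
    then obtain r where r: "incident r (abs_cp2 m)" "p = projective_extension A t r"
      by (auto simp: line_points_def)
    obtain v where "v \<noteq> 0" "r = abs_cp2 v" by (rule cp2_cases)
    then show "p \<in> line_points (abs_cp2 (reflect_line l m))"
      using r on At(2) by (simp add: line_points_def)
  qed
  then show ?thesis
    using At(1) n l by (auto simp: symmetric_nonisotropic_def isotropic_nform)
qed

text \<open>Continuity of the projection, which is how a limit of lines is reduced to one of coordinate
  vectors.\<close>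

lemma tendsto_abs_cp2:
  assumes "f \<longlonglongrightarrow> v" "v \<noteq> 0"
  shows "(\<lambda>n. abs_cp2 (f n)) \<longlonglongrightarrow> abs_cp2 v"
proof (rule topological_tendstoI)
  fix U assume U: "open U" "abs_cp2 v \<in> U"
  then have "open {v. v \<noteq> 0 \<and> abs_cp2 v \<in> U}" by (simp add: open_cp2_def)
  then have "\<forall>\<^sub>F n in sequentially. f n \<in> {v. v \<noteq> 0 \<and> abs_cp2 v \<in> U}"
    using assms U by (intro topological_tendstoD) auto
  then show "\<forall>\<^sub>F n in sequentially. abs_cp2 (f n) \<in> U"
    by (rule eventually_mono) auto
qed

lemma symmetric_lines_nonisotropic:
  assumes n: "nform l l \<noteq> 0" and m: "m \<noteq> 0" and v: "v \<noteq> 0"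
    and "pairing v l = 0" "pairing v m = 0"
  shows "symmetric_lines (abs_cp2 v) (abs_cp2 l) (abs_cp2 m) (abs_cp2 (reflect_line l m))"
proof -
  have l: "l \<noteq> 0" using n by (auto simp: nform_def)
  have "pairing v (reflect_line l m) = 0"
    using assms(4,5) by (simp add: pairing_reflect[symmetric] reflect_point_def)
  then show ?thesis
    using assms l symmetric_nonisotropic_reflect[OF n m] reflect_nonzero(1)[OF n m]
    by (simp add: symmetric_lines_def isotropic_nform incident_abs)
qed

text \<open>In an isotropic line \<open>l\<close>, every line \<open>m\<close> through a finite point of \<open>l\<close> reflects to \<open>l\<close>. Turn \<open>l\<close>
  about the point into non-isotropic lines \<open>L n\<close>. After multiplication by \<open>nform (L n) (L n)\<close>,
  which tends to \<open>0\<close>, the reflection of \<open>m\<close> in \<open>L n\<close> tends to \<open>-2 nform l m\<close> times \<open>l\<close>. If that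
  factor vanishes, \<open>m\<close> is parallel to \<open>l\<close>, hence equal to it, and the lines \<open>L n\<close>, each symmetric
  to itself, serve as the approximating lines.\<close>

lemma symmetric_lines_isotropic:
  assumes l: "l \<noteq> 0" "nform l l = 0" "abs_cp2 l \<noteq> line_at_infinity"
    and m: "m \<noteq> 0" and v: "v$3 \<noteq> 0" "pairing v l = 0" "pairing v m = 0"
  shows "symmetric_lines (abs_cp2 v) (abs_cp2 l) (abs_cp2 m) (abs_cp2 l)"
proof -
  have v0: "v \<noteq> 0" using v by auto
  have l12: "(l$1)\<^sup>2 + (l$2)\<^sup>2 = 0" using l(2) by (simp add: nform_def power2_eq_square)
  have l2: "l$2 \<noteq> 0"
  proof
    assume "l$2 = 0"
    with l12 have "l$1 = 0" by simp
    with \<open>l$2 = 0\<close> have "l = l$3 *s vector [0, 0, 1]" by (simp add: vec3_eq_iff)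
    then have "abs_cp2 l = line_at_infinity"
      using l(1) abs_cp2_scale[of "vector [0, 0, 1]" "l$3"]
      by (metis line_at_infinity_def vector_mul_eq_0)
    with l(3) show False by simp
  qed
  define e :: "nat \<Rightarrow> complex" where "e = (\<lambda>n. 1 / of_nat (Suc n))"
  have e: "e \<longlonglongrightarrow> 0"
    unfolding e_def by (rule LIMSEQ_Suc[OF lim_1_over_n])
  have e': "e n * (2 + e n) \<noteq> 0" for n :: nat
  proof -
    have "e n = complex_of_real (1 / real (Suc n))" by (simp add: e_def)
    then have "e n * (2 + e n) = complex_of_real (1 / real (Suc n) * (2 + 1 / real (Suc n)))"
      by simp
    moreover have "1 / real (Suc n) * (2 + 1 / real (Suc n)) > 0"
      by (intro mult_pos_pos add_pos_pos) auto
    ultimately show ?thesis by (metis less_irrefl of_real_eq_0_iff)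
  qed
  \<comment> \<open>The added vector is orthogonal to \<open>v\<close>; it is scaled by \<open>l\<^sub>2\<close> so that the isotropic form of \<open>L n\<close>
    becomes \<open>l\<^sub>2\<^sup>2 e n (2 + e n)\<close>, which is visibly non-zero.\<close>
  define L where "L n = l + e n *s (vector [0, l$2, - l$2 * v$2 / v$3] :: complex^3)" for n :: nat
  have L_lim: "L \<longlonglongrightarrow> l"
  proof -
    have "(\<lambda>n. L n $ i) \<longlonglongrightarrow> l$i + 0 * (vector [0, l$2, - l$2 * v$2 / v$3] :: complex^3)$i" for i
      unfolding L_def vector_add_component vector_smult_component
      by (intro tendsto_intros e)
    then show ?thesis by (intro vec_tendstoI) simp
  qed
  have Lv: "pairing v (L n) = 0" for n
    using v by (simp add: L_def pairing_3 algebra_simps)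
  have "nform (L n) (L n) = (l$1)\<^sup>2 + (l$2)\<^sup>2 + (l$2)\<^sup>2 * (e n * (2 + e n))" for n
    by (simp add: nform_def L_def power2_eq_square algebra_simps)
  then have Ln: "nform (L n) (L n) \<noteq> 0" for n
    using e'[of n] l2 l12 by simp
  have L0: "L n \<noteq> 0" for n
  proof
    assume "L n = 0"
    with Ln[of n] show False by (simp add: nform_def)
  qed
  have main: "symmetric_lines (abs_cp2 v) (abs_cp2 l) (abs_cp2 m) (abs_cp2 l)"
    if lim: "(\<lambda>n. abs_cp2 (M n)) \<longlonglongrightarrow> abs_cp2 m" "(\<lambda>n. abs_cp2 (reflect_line (L n) (M n))) \<longlonglongrightarrow> abs_cp2 l"
      and M: "\<And>n. M n \<noteq> 0" "\<And>n. pairing v (M n) = 0" for M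
  proof -
    have r: "pairing v (reflect_line (L n) (M n)) = 0" for n
      using Lv M by (simp add: pairing_reflect[symmetric] reflect_point_def)
    have "(\<lambda>n. (abs_cp2 (M n), abs_cp2 (reflect_line (L n) (M n)), abs_cp2 (L n), abs_cp2 v))
        \<longlonglongrightarrow> (abs_cp2 m, abs_cp2 l, abs_cp2 l, abs_cp2 v)"
      by (intro tendsto_Pair lim tendsto_const tendsto_abs_cp2[OF L_lim] l)
    moreover have "\<forall>n. incident (abs_cp2 v) (abs_cp2 (M n)) \<and>
        incident (abs_cp2 v) (abs_cp2 (reflect_line (L n) (M n))) \<and> incident (abs_cp2 v) (abs_cp2 (L n)) \<and>
        symmetric_nonisotropic (abs_cp2 (L n)) (abs_cp2 (M n)) (abs_cp2 (reflect_line (L n) (M n)))"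
      using symmetric_nonisotropic_reflect[OF Ln M(1)] reflect_nonzero(1)[OF Ln M(1)]
      by (simp add: incident_abs v0 M L0 r Lv)
    ultimately show ?thesis
      unfolding symmetric_lines_def isotropic_nform[OF l(1)]
      using l m v v0 by (simp add: incident_abs) (intro exI, rule conjI, assumption+)
  qed
  show ?thesis
  proof (cases "nform l m = 0")
    case True
    have "cross l m = 0"
    proof -
      have "l$1 * (l$1 * m$2 - l$2 * m$1) = 0" "l$2 * (l$1 * m$2 - l$2 * m$1) = 0"
        using True l12 unfolding nform_def by algebra+
      then have c3: "l$1 * m$2 - l$2 * m$1 = 0" using l2 by simp
      have "v$3 * (l$2 * m$3 - l$3 * m$2) = 0" "v$3 * (l$3 * m$1 - l$1 * m$3) = 0"
        using c3 v(2,3) unfolding pairing_3 by algebra+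
      then show ?thesis using c3 v(1) by (simp add: cross_def vec3_eq_iff)
    qed
    then have lm: "abs_cp2 l = abs_cp2 m" using cross_eq_0_iff l(1) m by blast
    have "reflect_line (L n) (L n) = (-1) *s L n" for n
      using Ln[of n] by (simp add: reflect_line_def vec3_eq_iff)
    then have "abs_cp2 (reflect_line (L n) (L n)) = abs_cp2 (L n)" for n
      using abs_cp2_scale[OF L0, of "-1"] by simp
    then show ?thesis
      using tendsto_abs_cp2[OF L_lim l(1)] L0 Lv by (intro main[of L]) (simp_all add: lm)
  next
    case False
    define R where "R n = nform (L n) (L n) *s m - (2 * nform (L n) m) *s L n" for n
    have "abs_cp2 (reflect_line (L n) m) = abs_cp2 (R n)" for n
    proof -
      have "R n = nform (L n) (L n) *s reflect_line (L n) m"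
        using Ln[of n] by (simp add: R_def reflect_line_def vec3_eq_iff right_diff_distrib)
      then show ?thesis
        using abs_cp2_scale[OF reflect_nonzero(1)[OF Ln m] Ln] by simp
    qed
    moreover have "R \<longlonglongrightarrow> (- 2 * nform l m) *s l"
    proof -
      have "(\<lambda>n. R n $ i) \<longlonglongrightarrow> nform l l * m$i - 2 * nform l m * l$i" for i
        unfolding R_def nform_def vector_minus_component vector_smult_component
        by (intro tendsto_intros tendsto_vec_nth L_lim)
      then show ?thesis using l(2) by (intro vec_tendstoI) simp
    qed
    then have "(\<lambda>n. abs_cp2 (R n)) \<longlonglongrightarrow> abs_cp2 l"
      using tendsto_abs_cp2[of R "(- 2 * nform l m) *s l"] abs_cp2_scale[OF l(1), of "- 2 * nform l m"]
        False l(1) by simp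
    ultimately show ?thesis
      using m v(3) by (intro main[of "\<lambda>n. m"]) simp_all
  qed
qed

section \<open>Confocal conics are complex caustics\<close>

text \<open>The dual conic of the confocal conic with parameter \<open>\<mu>\<close>. It is affine in \<open>\<mu>\<close> with slope minus
  the isotropic form: dually, a confocal family is a pencil.\<close>

definition confocal_form :: "complex \<Rightarrow> complex \<Rightarrow> complex \<Rightarrow> complex^3 \<Rightarrow> complex" where
  "confocal_form A B \<mu> m = (A - \<mu>) * (m$1)\<^sup>2 + (B - \<mu>) * (m$2)\<^sup>2 - (m$3)\<^sup>2"

lemma tangent_to_confocal:
  assumes "\<mu> \<noteq> A" "\<mu> \<noteq> B" "k \<noteq> 0"
  shows "tangent_to (abs_cp2 k) (central_conic (A - \<mu>) (B - \<mu>)) \<longleftrightarrow> confocal_form A B \<mu> k = 0"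
  using tangent_to_central[of "A - \<mu>" "B - \<mu>" k] assms by (simp add: confocal_form_def)

text \<open>The reason why confocal conics are caustics. For \<open>\<mu> = 0\<close> the dual form vanishes at the tangent
  \<open>l\<close>, and \<open>l\<close> is orthogonal for it to all lines through the point of contact. So on these lines
  only the isotropic part of the dual form changes along \<open>l\<close>, and the reflection in \<open>l\<close> preserves
  that part: the increment vanishes for \<open>c = 2 nform l m / nform l l\<close>.\<close>

lemma confocal_form_reflect:
  assumes AB: "A \<noteq> 0" "B \<noteq> 0" and on: "(v$1)\<^sup>2 / A + (v$2)\<^sup>2 / B = (v$3)\<^sup>2"
    and m: "pairing v m = 0"
  defines "l \<equiv> central_gradient A B v"
  shows "confocal_form A B \<mu> (m - c *s l) =
    confocal_form A B \<mu> m + \<mu> * c * (2 * nform l m - c * nform l l)"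
proof -
  have l: "A * l$1 = v$1" "B * l$2 = v$2" "l$3 = - v$3"
    using AB by (simp_all add: l_def central_gradient_def)
  have "A * (l$1)\<^sup>2 + B * (l$2)\<^sup>2 = (l$3)\<^sup>2"
    using on AB by (simp add: l_def central_gradient_def field_simps power2_eq_square)
  then show ?thesis
    using l m unfolding confocal_form_def nform_def pairing_3 vector_minus_component vector_smult_component
    by algebra
qed

text \<open>A line through the point is \<open>m - c l\<close> up to a factor, or \<open>l\<close>, and \<open>l\<close> is not tangent since its
  dual form is \<open>- \<mu> nform l l\<close>. The increment of the dual form along \<open>l\<close> is a quadratic polynomial
  in \<open>c\<close> whose two roots give \<open>m\<close> and its reflection. Consequently a triangle inscribed in a conic
  and circumscribed about a confocal one satisfies the law of reflection at its vertices.\<close>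

lemma tangents_through_conic_point:
  assumes AB: "A \<noteq> 0" "B \<noteq> 0" and mu: "\<mu> \<noteq> 0" "\<mu> \<noteq> A" "\<mu> \<noteq> B"
    and v: "v \<noteq> 0" "(v$1)\<^sup>2 / A + (v$2)\<^sup>2 / B = (v$3)\<^sup>2"
    and m: "m \<noteq> 0" "pairing v m = 0" "confocal_form A B \<mu> m = 0"
    and n: "nform (central_gradient A B v) (central_gradient A B v) \<noteq> 0"
  shows "{t. tangent_to t (central_conic (A - \<mu>) (B - \<mu>)) \<and> incident (abs_cp2 v) t} =
    {abs_cp2 m, abs_cp2 (reflect_line (central_gradient A B v) m)}"
proof -
  define l where "l = central_gradient A B v"
  have l0: "l \<noteq> 0" using n by (auto simp: l_def nform_def)
  note tan = tangent_to_confocal[OF mu(2,3)]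
  have vl: "pairing v l = 0"
    using v AB by (simp add: l_def central_gradient_def pairing_3 power2_eq_square)
  have form_l: "confocal_form A B \<mu> l = - \<mu> * nform l l"
  proof -
    have "A * (l$1)\<^sup>2 + B * (l$2)\<^sup>2 = (l$3)\<^sup>2"
      using v(2) AB by (simp add: l_def central_gradient_def field_simps power2_eq_square)
    then show ?thesis unfolding confocal_form_def nform_def by algebra
  qed
  have nl: "nform l l \<noteq> 0" using n by (simp add: l_def)
  have form_sub: "confocal_form A B \<mu> (m - c *s l) = \<mu> * c * (2 * nform l m - c * nform l l)" for c
    using confocal_form_reflect[OF AB v(2) m(2)] m(3) by (simp add: l_def)
  have lm: "abs_cp2 l \<noteq> abs_cp2 m"
  proof
    assume "abs_cp2 l = abs_cp2 m"
    then have "confocal_form A B \<mu> l = 0" using tan l0 m(1,3) by metis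
    then show False using form_l mu(1) nl by simp
  qed
  have "k = abs_cp2 m \<or> k = abs_cp2 (reflect_line l m)"
    if "tangent_to k (central_conic (A - \<mu>) (B - \<mu>))" "incident (abs_cp2 v) k" for k
  proof -
    obtain t where t: "t \<noteq> 0" "k = abs_cp2 t" by (rule cp2_cases)
    \<comment> \<open>\<open>l\<close> and \<open>m\<close> span the pencil of lines through the point, by Cramer's rule with a non-zero minor.\<close>
    have lmv: "abs_cp2 (cross l m) = abs_cp2 v"
      using line_through_two_points[of l m v] l0 m(1,2) v(1) lm vl
      by (simp add: pairing_3 mult.commute)
    have "cross l m \<noteq> 0" using lm cross_eq_0_iff l0 m(1) by blast
    then have "pairing (cross l m) t = 0"
      using lmv that(2) t v(1) by (metis incident_abs)
    obtain x y where xy: "t = x *s m - y *s l"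
    proof -
      obtain i where i: "cross l m $ i \<noteq> 0" using \<open>cross l m \<noteq> 0\<close> by (auto simp: vec_eq_iff)
      have e: "cross l m $ 1 * t$1 + cross l m $ 2 * t$2 + cross l m $ 3 * t$3 = 0"
        using \<open>pairing (cross l m) t = 0\<close> by (simp add: pairing_3)
      have "\<exists>x y. cross l m $ i *s t = x *s m - y *s l"
        using exhaust_3[of i]
      proof (elim disjE)
        assume "i = 1"
        have "cross l m $ 1 *s t = (l$2 * t$3 - l$3 * t$2) *s m - (m$2 * t$3 - m$3 * t$2) *s l"
          using e by (simp add: vec3_eq_iff cross_def) algebra
        then show ?thesis using \<open>i = 1\<close> by blast
      next
        assume "i = 2"
        have "cross l m $ 2 *s t = (l$3 * t$1 - l$1 * t$3) *s m - (m$3 * t$1 - m$1 * t$3) *s l"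
          using e by (simp add: vec3_eq_iff cross_def) algebra
        then show ?thesis using \<open>i = 2\<close> by blast
      next
        assume "i = 3"
        have "cross l m $ 3 *s t = (l$1 * t$2 - l$2 * t$1) *s m - (m$1 * t$2 - m$2 * t$1) *s l"
          using e by (simp add: vec3_eq_iff cross_def) algebra
        then show ?thesis using \<open>i = 3\<close> by blast
      qed
      then obtain x y where "cross l m $ i *s t = x *s m - y *s l" by blast
      then have "t = (x / cross l m $ i) *s m - (y / cross l m $ i) *s l"
        using i by (simp add: vec_eq_iff field_simps)
      then show thesis by (rule that)
    qed
    have "x \<noteq> 0"
    proof
      assume "x = 0"
      then have "t = (- y) *s l" "y \<noteq> 0" using xy t(1) by auto
      then have "k = abs_cp2 l" using t(2) abs_cp2_scale[OF l0, of "- y"] by simp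
      then have "confocal_form A B \<mu> l = 0" using that(1) tan l0 by simp
      then show False using form_l mu(1) nl by simp
    qed
    define c where "c = y / x"
    have tc: "t = x *s (m - c *s l)"
      using xy \<open>x \<noteq> 0\<close> by (simp add: c_def vec_eq_iff right_diff_distrib)
    then have c0: "m - c *s l \<noteq> 0" using t(1) by auto
    have kc: "k = abs_cp2 (m - c *s l)"
      unfolding t(2) tc by (rule abs_cp2_scale[OF c0 \<open>x \<noteq> 0\<close>])
    then have "confocal_form A B \<mu> (m - c *s l) = 0" using that(1) tan c0 by simp
    then have "c = 0 \<or> c = 2 * nform l m / nform l l"
      using form_sub mu(1) nl by (auto simp: field_simps)
    then show ?thesis using kc by (auto simp: reflect_line_def)
  qed
  moreover have "confocal_form A B \<mu> (reflect_line l m) = 0"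
    using nl by (simp add: reflect_line_def form_sub)
  moreover have "pairing v (reflect_line l m) = 0"
    using m(2) vl by (simp add: pairing_reflect[symmetric] reflect_point_def)
  ultimately show ?thesis
    using m v(1) tan reflect_nonzero(1)[OF nl m(1)] by (auto simp: l_def[symmetric] incident_abs)
qed

text \<open>At an isotropic tangent \<open>l\<close> the reflection degenerates and every line reflects to \<open>l\<close>. But
  isotropic tangents are common to all confocal conics, the dual forms of which differ only by
  multiples of the isotropic form, so the reflected line is again tangent.\<close>

lemma confocal_complex_caustic:
  assumes AB: "A \<noteq> 0" "B \<noteq> 0" "A \<noteq> B" and mu: "\<mu> \<noteq> A" "\<mu> \<noteq> B"
  shows "complex_caustic (central_conic A B) (central_conic (A - \<mu>) (B - \<mu>))"
  unfolding complex_caustic_def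
proof (intro allI impI ballI)
  fix t p
  assume t: "tangent_to t (central_conic (A - \<mu>) (B - \<mu>))"
    and p: "p \<in> line_points t \<inter> conic_points (central_conic A B)"
  obtain v where v: "v \<noteq> 0" "p = abs_cp2 v" by (rule cp2_cases)
  obtain m where m: "m \<noteq> 0" "t = abs_cp2 m" by (rule cp2_cases)
  define l where "l = central_gradient A B v"
  note tan = tangent_to_confocal[OF mu]
  have l0: "l \<noteq> 0" unfolding l_def by (rule central_gradient_nonzero[OF AB(1,2) v(1)])
  have T: "tangent_line (central_conic A B) p = abs_cp2 l"
    using tangent_line_central[OF AB(1,2) v(1)] v by (simp add: l_def)
  have on: "(v$1)\<^sup>2 / A + (v$2)\<^sup>2 / B = (v$3)\<^sup>2"
    using p v central_conic_points_abs[OF AB(1,2)] by simp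
  have vm: "pairing v m = 0"
    using p v m by (simp add: line_points_def incident_abs)
  have vl: "pairing v l = 0"
    using on AB by (simp add: l_def central_gradient_def pairing_3 power2_eq_square)
  have mt: "confocal_form A B \<mu> m = 0" using t m tan by simp
  show "\<exists>t'. symmetric_lines p (tangent_line (central_conic A B) p) t t' \<and>
      tangent_to t' (central_conic (A - \<mu>) (B - \<mu>))"
  proof (cases "nform l l = 0")
    case False
    have "confocal_form A B \<mu> (reflect_line l m) = 0"
      using False mt confocal_form_reflect[OF AB(1,2) on vm, folded l_def]
      by (simp add: reflect_line_def)
    then show ?thesis
      using symmetric_lines_nonisotropic[OF False m(1) v(1) vl vm] v m T tan
        reflect_nonzero(1)[OF False m(1)] by auto
  next
    case True
    have l12: "l$1 * A = v$1" "l$2 * B = v$2" "l$3 = - v$3"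
      using AB by (simp_all add: l_def central_gradient_def)
    have dual: "A * (l$1)\<^sup>2 + B * (l$2)\<^sup>2 = (l$3)\<^sup>2"
      using on AB by (simp add: l_def central_gradient_def field_simps power2_eq_square)
    have iso: "(l$1)\<^sup>2 + (l$2)\<^sup>2 = 0" using True by (simp add: nform_def power2_eq_square)
    have fl: "confocal_form A B \<mu> l = 0" using dual iso unfolding confocal_form_def by algebra
    \<comment> \<open>An isotropic tangent at a point at infinity would force \<open>A = B\<close>, the case of a circle.\<close>
    have "v$3 \<noteq> 0"
    proof
      assume "v$3 = 0"
      then have "(A - B) * (l$1)\<^sup>2 = 0" "(A - B) * (l$2)\<^sup>2 = 0"
        using dual iso l12(3) by algebra+
      then have "l = 0" using AB(3) l12(3) \<open>v$3 = 0\<close> by (simp add: vec3_eq_iff)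
      then show False using l0 by simp
    qed
    moreover have "abs_cp2 l \<noteq> line_at_infinity"
    proof
      assume "abs_cp2 l = line_at_infinity"
      then have "incident (abs_cp2 (vector [1, 0, 0])) (abs_cp2 l)"
        "incident (abs_cp2 (vector [0, 1, 0])) (abs_cp2 l)"
        by (simp_all add: line_at_infinity_def incident_abs vec3_eq_iff pairing_3)
      then have "l$1 = 0" "l$2 = 0"
        using l0 by (simp_all add: incident_abs vec3_eq_iff pairing_3)
      then have "l$3 = 0" using dual by simp
      then show False using l0 \<open>l$1 = 0\<close> \<open>l$2 = 0\<close> by (simp add: vec3_eq_iff)
    qed
    ultimately have "symmetric_lines p (abs_cp2 l) t (abs_cp2 l)"
      using symmetric_lines_isotropic[OF l0 True _ m(1) _ vl vm] v m by simp
    then show ?thesis using T tan[OF l0] fl by auto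
  qed
qed

section \<open>Cayley's condition for triangles\<close>

lemma trace_3: "trace (M :: complex^3^3) = M$1$1 + M$2$2 + M$3$3"
  by (simp add: trace_def sum_3)

lemma symmetric_matrix_entry:
  assumes "transpose M = M"
  shows "M$i$j = M$j$i"
  using arg_cong[OF assms, of "\<lambda>A. A$j$i"] by (simp add: transpose_def)

text \<open>The invariant form of the closing condition. If \<open>\<alpha>, \<beta>, \<gamma>\<close> are the products of corresponding
  off-diagonal entries of \<open>M\<close> and \<open>N\<close>, then \<open>M N\<close> has trace \<open>2 (\<alpha> + \<beta> + \<gamma>)\<close>, and the sum of its
  principal \<open>2 \<times> 2\<close> minors is \<open>(\<alpha> + \<beta> + \<gamma>)\<^sup>2\<close>; the identity expresses the relation between the two
  by power sums of the eigenvalues.\<close>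

lemma hollow_trace_identity:
  fixes M N :: "complex^3^3"
  assumes "transpose M = M" "transpose N = N" "\<And>i. M$i$i = 0" "\<And>i. N$i$i = 0"
  shows "2 * trace ((M ** N) ** (M ** N)) = (trace (M ** N))\<^sup>2"
proof -
  note s = symmetric_matrix_entry[OF assms(1), of 2 1] symmetric_matrix_entry[OF assms(1), of 3 1]
    symmetric_matrix_entry[OF assms(1), of 3 2] symmetric_matrix_entry[OF assms(2), of 2 1]
    symmetric_matrix_entry[OF assms(2), of 3 1] symmetric_matrix_entry[OF assms(2), of 3 2]
  have t: "trace (K ** K) = (K$1$1)\<^sup>2 + (K$2$2)\<^sup>2 + (K$3$3)\<^sup>2
     + 2 * (K$1$2 * K$2$1 + K$1$3 * K$3$1 + K$2$3 * K$3$2)" for K :: "complex^3^3"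
    by (simp add: trace_3 matrix_matrix_mult_def sum_3 power2_eq_square)
  have e: "(M ** N)$i$j = M$i$1 * N$1$j + M$i$2 * N$2$j + M$i$3 * N$3$j" for i j
    by (simp add: matrix_matrix_mult_def sum_3)
  show ?thesis
    unfolding t unfolding trace_3 e assms(3,4) s by algebra
qed

lemma trace_diag:
  fixes p q r :: complex
  defines "X \<equiv> vector [vector [p, 0, 0], vector [0, q, 0], vector [0, 0, r]] :: complex^3^3"
  shows "trace X = p + q + r" "trace (X ** X) = p\<^sup>2 + q\<^sup>2 + r\<^sup>2"
  by (simp_all add: X_def trace_3 matrix_matrix_mult_def sum_3 power2_eq_square)

text \<open>With \<open>P = (a - \<mu>) / a\<close> and \<open>R = (b - \<mu>) / b\<close> this is \<open>a\<^sup>2 b\<^sup>2\<close> times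
  \<open>P\<^sup>2 + R\<^sup>2 + 1 - 2 P R - 2 P - 2 R\<close>, Cayley's condition for triangles inscribed in the conic with
  squared semi-axes \<open>a, b\<close> and circumscribed about the confocal conic with parameter \<open>\<mu>\<close>.\<close>

definition poncelet_form :: "'a::comm_ring_1 \<Rightarrow> 'a \<Rightarrow> 'a \<Rightarrow> 'a" where
  "poncelet_form a b \<mu> = (a - b)\<^sup>2 * \<mu>\<^sup>2 + 2 * a * b * (a + b) * \<mu> - 3 * a\<^sup>2 * b\<^sup>2"

text \<open>Two distinct conjugate points of a smooth conic would both have their joining line as
  tangent, but the gradient map is injective.\<close>

lemma polar_pairing_nonzero:
  assumes AB: "A \<noteq> 0" "B \<noteq> 0" and u: "u \<noteq> 0" "v \<noteq> 0" "abs_cp2 u \<noteq> abs_cp2 v"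
    and on: "pairing u (central_gradient A B u) = 0" "pairing v (central_gradient A B v) = 0"
  shows "pairing u (central_gradient A B v) \<noteq> 0"
proof
  assume polar: "pairing u (central_gradient A B v) = 0"
  then have polar': "pairing v (central_gradient A B u) = 0"
    by (simp add: pairing_3 central_gradient_def mult.commute)
  have nz: "central_gradient A B u \<noteq> 0" "central_gradient A B v \<noteq> 0"
    using central_gradient_nonzero[OF AB] u by simp_all
  have "abs_cp2 (central_gradient A B u) = abs_cp2 (central_gradient A B v)"
    using line_through_two_points[OF u(1,2) nz(1) u(3)] line_through_two_points[OF u(1,2) nz(2) u(3)]
      on polar polar' by simp
  then obtain c where "c \<noteq> 0" "central_gradient A B v = c *s central_gradient A B u"
    using abs_cp2_eq_iff[OF nz] by blast
  then have "v = c *s u"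
    using AB by (simp add: central_gradient_def vec3_eq_iff field_simps)
  then show False using abs_cp2_scale[OF u(1) \<open>c \<noteq> 0\<close>] u(3) by simp
qed

text \<open>In the projective frame of the vertices, the matrix \<open>M\<close> of the outer conic has zero diagonal since
  the vertices lie on it, and the dual matrix \<open>N\<close> of the inner conic has zero diagonal since the
  sides are tangent to it. The product \<open>M N\<close> is similar to \<open>D Q\<close>, the product of the same matrices
  in the original coordinates, so \<open>hollow_trace_identity\<close> holds for \<open>D Q\<close>, which is diagonal.\<close>

lemma circumscribed_orbit_condition:
  assumes AB: "A \<noteq> 0" "B \<noteq> 0" and mu: "\<mu> \<noteq> A" "\<mu> \<noteq> B"
    and orb: "periodic_orbit_3 (central_conic A B) p"
    and circ: "circumscribed_about p (central_conic (A - \<mu>) (B - \<mu>))"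
  shows "poncelet_form A B \<mu> = 0"
proof -
  define D :: "complex^3^3" where
    "D = vector [vector [1 / A, 0, 0], vector [0, 1 / B, 0], vector [0, 0, -1]]"
  define Q :: "complex^3^3" where
    "Q = vector [vector [A - \<mu>, 0, 0], vector [0, B - \<mu>, 0], vector [0, 0, -1]]"
  define X :: "complex^3^3" where
    "X = vector [vector [(A - \<mu>) / A, 0, 0], vector [0, (B - \<mu>) / B, 0], vector [0, 0, 1]]"
  have DQ: "D ** Q = X"
    by (simp add: D_def Q_def X_def matrix_matrix_mult_def vec_eq_iff forall_3 sum_3)
  have "\<exists>v. v \<noteq> 0 \<and> p j = abs_cp2 v" for j
    by (rule cp2_cases[of "p j"]) blast
  then obtain v where v: "v j \<noteq> 0" "p j = abs_cp2 (v j)" for j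
    using choice[of "\<lambda>j v. v \<noteq> 0 \<and> p j = abs_cp2 v"] by blast
  define V :: "complex^3^3" where "V = (\<chi> j. v j)"
  define M where "M = V ** D ** transpose V"
  have tD: "transpose D = D" and tQ: "transpose Q = Q"
    by (simp_all add: D_def Q_def transpose_def vec_eq_iff forall_3)
  have tM: "transpose M = M"
    by (simp add: M_def matrix_transpose_mul tD matrix_mul_assoc)
  have M: "M$i$j = pairing (v i) (central_gradient A B (v j))" for i j
    by (simp add: M_def V_def D_def central_gradient_def pairing_3 matrix_matrix_mult_def
        transpose_def sum_3)
  have on: "pairing (v j) (central_gradient A B (v j)) = 0" for j
  proof -
    have "p j \<in> conic_points (central_conic A B)" using orb by (simp add: periodic_orbit_3_def)
    then show ?thesis
      using v(2)[of j] central_conic_points_abs[OF AB v(1)[of j]]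
      by (simp add: central_gradient_def pairing_3 power2_eq_square)
  qed
  have M0: "M$j$j = 0" for j using on by (simp add: M)
  have step: "p j \<noteq> p (j + 1)" for j using orb by (simp add: periodic_orbit_3_def)
  have ne: "p i \<noteq> p j" if "i \<noteq> j" for i j
  proof -
    have "(3::3) + 1 = 1" by simp
    then have "p 1 \<noteq> p 2" "p 2 \<noteq> p 3" "p 3 \<noteq> p 1"
      using step[of 1] step[of 2] step[of 3] by (simp_all only: one_add_one) simp_all
    then show ?thesis using that exhaust_3[of i] exhaust_3[of j] by auto
  qed
  have Mne: "M$i$j \<noteq> 0" if "i \<noteq> j" for i j
    using polar_pairing_nonzero[OF AB v(1) v(1) _ on on] ne[OF that] v(2) by (simp add: M)
  \<comment> \<open>The vertices are not collinear, so they can serve as a frame.\<close>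
  have "det M = 2 * M$1$2 * M$2$3 * M$1$3"
    by (simp add: det_3 M0 symmetric_matrix_entry[OF tM, of 2 1] symmetric_matrix_entry[OF tM, of 3 1]
        symmetric_matrix_entry[OF tM, of 3 2])
  then have "det M \<noteq> 0" using Mne[of 1 2] Mne[of 2 3] Mne[of 1 3] by simp
  then have "det V \<noteq> 0" by (auto simp: M_def det_mul)
  then obtain W where VW: "V ** W = mat 1" and WV: "W ** V = mat 1"
    using invertible_det_nz invertible_def by blast
  define N where "N = transpose W ** Q ** W"
  have tN: "transpose N = N"
    by (simp add: N_def matrix_transpose_mul tQ matrix_mul_assoc)
  define w where "w i = (\<chi> k. W$k$i)" for i
  have vw: "pairing (v j) (w i) = (if j = i then 1 else 0)" for i j
  proof -
    have "pairing (v j) (w i) = (V ** W)$j$i"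
      by (simp add: pairing_def w_def V_def matrix_matrix_mult_def)
    then show ?thesis by (simp add: VW mat_def)
  qed
  \<comment> \<open>The dual frame consists of the sides, \<open>w i\<close> being the side opposite to vertex \<open>i\<close>.\<close>
  have w0: "w i \<noteq> 0" for i using vw[of i i] by (auto simp: pairing_def)
  have N0: "N$i$i = 0" for i
  proof -
    have i: "i + 1 \<noteq> i" "i + 2 \<noteq> i" "i + 1 \<noteq> i + 2" "i + 1 + 1 = i + 2"
      by simp_all
    have "incident (p (i + 1)) (abs_cp2 (w i))" "incident (p (i + 2)) (abs_cp2 (w i))"
      using v w0 vw i by (simp_all add: incident_abs)
    then have "join (p (i + 1)) (p (i + 2)) = abs_cp2 (w i)"
      using join_eqI ne[OF i(3)] by blast
    moreover have "join (p (i + 1)) (p (i + 1 + 1)) \<in>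
        {l. tangent_to l (central_conic (A - \<mu>) (B - \<mu>)) \<and> incident (p (i + 1)) l}"
      using circ unfolding circumscribed_about_def by blast
    ultimately have "tangent_to (abs_cp2 (w i)) (central_conic (A - \<mu>) (B - \<mu>))"
      using i by simp
    then have "(A - \<mu>) * (w i $ 1)\<^sup>2 + (B - \<mu>) * (w i $ 2)\<^sup>2 = (w i $ 3)\<^sup>2"
      using tangent_to_central[of "A - \<mu>" "B - \<mu>" "w i"] mu w0 by simp
    then show ?thesis
      by (simp add: N_def w_def Q_def matrix_matrix_mult_def transpose_def sum_3 power2_eq_square
          algebra_simps)
  qed
  have tVW: "transpose V ** transpose W = mat 1"
    by (metis WV matrix_transpose_mul transpose_mat)
  have MN: "M ** N = V ** X ** W"
  proof -
    have "M ** N = V ** D ** (transpose V ** transpose W) ** Q ** W"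
      by (simp add: M_def N_def matrix_mul_assoc)
    also have "\<dots> = V ** X ** W"
      unfolding tVW DQ[symmetric] by (simp add: matrix_mul_assoc)
    finally show ?thesis .
  qed
  have conj: "trace (V ** Y ** W) = trace Y" for Y :: "complex^3^3"
    by (metis WV matrix_mul_assoc matrix_mul_lid trace_mul_sym)
  have "(V ** X ** W) ** (V ** X ** W) = V ** X ** (W ** V) ** X ** W"
    by (simp add: matrix_mul_assoc)
  then have "(M ** N) ** (M ** N) = V ** (X ** X) ** W"
    by (simp add: MN WV matrix_mul_assoc)
  then have "2 * trace (X ** X) = (trace X)\<^sup>2"
    using hollow_trace_identity[OF tM tN M0 N0] conj by (simp add: MN)
  then have "2 * (((A - \<mu>) / A)\<^sup>2 + ((B - \<mu>) / B)\<^sup>2 + 1) = ((A - \<mu>) / A + (B - \<mu>) / B + 1)\<^sup>2"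
    by (simp add: X_def trace_diag)
  moreover define P R where "P = (A - \<mu>) / A" and "R = (B - \<mu>) / B"
  ultimately have PR: "2 * (P\<^sup>2 + R\<^sup>2 + 1) = (P + R + 1)\<^sup>2" "A * P = A - \<mu>" "B * R = B - \<mu>"
    using AB by simp_all
  have "A\<^sup>2 * B\<^sup>2 * (P\<^sup>2 + R\<^sup>2 + 1 - 2 * P * R - 2 * P - 2 * R) = 0"
    using PR(1) by algebra
  then show ?thesis unfolding poncelet_form_def using PR(2,3) by algebra
qed

section \<open>The triangles of the two caustics\<close>

lemma divide_sum_eq_iff:
  fixes a b :: complex
  assumes "a \<noteq> 0" "b \<noteq> 0"
  shows "x / a + y / b = z \<longleftrightarrow> b * x + a * y = a * b * z"
  using assms by (simp add: field_simps)

text \<open>Both equations are linear in the squares of the coordinates, and for distinct confocal conics they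
  determine these squares up to a common factor. None of the squares vanishes, so the choices of sign
  give four points.\<close>

lemma confocal_general_position:
  assumes AB: "A \<noteq> 0" "B \<noteq> 0" "A \<noteq> B" and mu: "\<mu> \<noteq> 0" "\<mu> \<noteq> A" "\<mu> \<noteq> B"
  shows "general_position (central_conic A B) (central_conic (A - \<mu>) (B - \<mu>))"
proof -
  define x where "x = csqrt (A * (A - \<mu>) / (A - B))"
  define y where "y = csqrt (B * (B - \<mu>) / (B - A))"
  have x2: "(A - B) * x\<^sup>2 = A * (A - \<mu>)" and y2: "(A - B) * y\<^sup>2 = - (B * (B - \<mu>))"
    using AB by (simp_all add: x_def y_def field_simps)
  have nz: "x \<noteq> 0" "y \<noteq> 0" using AB mu by (auto simp: x_def y_def)
  let ?P = "\<lambda>s t. abs_cp2 (vector [s, t, 1])"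
  have v0: "vector [s, t, 1] \<noteq> (0::complex^3)" for s t by (simp add: vec3_eq_iff)
  have inj: "?P s t = ?P s' t' \<longleftrightarrow> s = s' \<and> t = t'" for s t s' t'
    by (auto simp: abs_cp2_eq_iff v0 vec3_eq_iff)
  have both: "abs_cp2 v \<in> conic_points (central_conic A B) \<inter> conic_points (central_conic (A - \<mu>) (B - \<mu>))
      \<longleftrightarrow> (v$1)\<^sup>2 = x\<^sup>2 * (v$3)\<^sup>2 \<and> (v$2)\<^sup>2 = y\<^sup>2 * (v$3)\<^sup>2" (is "?on \<longleftrightarrow> ?eq")
    if v: "v \<noteq> 0" for v
  proof -
    have "?on \<longleftrightarrow> B * (v$1)\<^sup>2 + A * (v$2)\<^sup>2 = A * B * (v$3)\<^sup>2 \<and>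
        (B - \<mu>) * (v$1)\<^sup>2 + (A - \<mu>) * (v$2)\<^sup>2 = (A - \<mu>) * (B - \<mu>) * (v$3)\<^sup>2"
      using AB mu v by (simp add: central_conic_points_abs divide_sum_eq_iff)
    also have "\<dots> \<longleftrightarrow> ?eq"
    proof
      assume *: "B * (v$1)\<^sup>2 + A * (v$2)\<^sup>2 = A * B * (v$3)\<^sup>2 \<and>
        (B - \<mu>) * (v$1)\<^sup>2 + (A - \<mu>) * (v$2)\<^sup>2 = (A - \<mu>) * (B - \<mu>) * (v$3)\<^sup>2"
      have "(A - B) * \<mu> * ((v$1)\<^sup>2 - x\<^sup>2 * (v$3)\<^sup>2) = 0" "(A - B) * \<mu> * ((v$2)\<^sup>2 - y\<^sup>2 * (v$3)\<^sup>2) = 0"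
        using * x2 y2 by algebra+
      then show ?eq using AB mu by simp
    next
      assume *: ?eq
      have "(A - B) * (B * (v$1)\<^sup>2 + A * (v$2)\<^sup>2 - A * B * (v$3)\<^sup>2) = 0"
        "(A - B) * ((B - \<mu>) * (v$1)\<^sup>2 + (A - \<mu>) * (v$2)\<^sup>2 - (A - \<mu>) * (B - \<mu>) * (v$3)\<^sup>2) = 0"
        using * x2 y2 by algebra+
      then show "B * (v$1)\<^sup>2 + A * (v$2)\<^sup>2 = A * B * (v$3)\<^sup>2 \<and>
        (B - \<mu>) * (v$1)\<^sup>2 + (A - \<mu>) * (v$2)\<^sup>2 = (A - \<mu>) * (B - \<mu>) * (v$3)\<^sup>2"
        using AB by simp
    qed
    finally show ?thesis .
  qed
  have corner: "?P s t \<in> conic_points (central_conic A B) \<inter> conic_points (central_conic (A - \<mu>) (B - \<mu>))"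
    if "s\<^sup>2 = x\<^sup>2" "t\<^sup>2 = y\<^sup>2" for s t
    using both[OF v0] that by simp
  have "conic_points (central_conic A B) \<inter> conic_points (central_conic (A - \<mu>) (B - \<mu>)) =
      {?P x y, ?P x (- y), ?P (- x) y, ?P (- x) (- y)}" (is "?I = ?S")
  proof (intro equalityI subsetI)
    fix p assume p: "p \<in> ?I"
    obtain v where v: "v \<noteq> 0" "p = abs_cp2 v" by (rule cp2_cases)
    have e: "(v$1)\<^sup>2 = (x * v$3)\<^sup>2" "(v$2)\<^sup>2 = (y * v$3)\<^sup>2"
      using p both v by (simp_all add: power_mult_distrib)
    have z: "v$3 \<noteq> 0"
    proof
      assume "v$3 = 0"
      then show False using e v by (simp add: vec3_eq_iff)
    qed
    have "v$1 = x * v$3 \<or> v$1 = - x * v$3" "v$2 = y * v$3 \<or> v$2 = - y * v$3"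
      using e by (simp_all add: power2_eq_iff)
    then obtain s t where st: "s = x \<or> s = - x" "t = y \<or> t = - y" "v$1 = s * v$3" "v$2 = t * v$3"
      by blast
    have "v = v$3 *s vector [s, t, 1]" using st by (simp add: vec3_eq_iff)
    then have "p = ?P s t" using v z abs_cp2_scale[OF v0] by metis
    then show "p \<in> ?S" using st by auto
  next
    fix p assume "p \<in> ?S"
    then show "p \<in> ?I" by (elim insertE emptyE; simp only:; intro corner; simp)
  qed
  moreover have "card ?S = 4" using nz by (simp add: inj)
  ultimately show ?thesis by (simp add: general_position_def)
qed

text \<open>For a triangle with vertices \<open>v j\<close> on the conic and opposite sides \<open>m j\<close> tangent to a confocal conic,
  the two sides at a vertex are different tangents through it, hence are all of them, and the second
  is the reflection of the first.\<close>

lemma tangent_triangle_orbit: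
  assumes AB: "A \<noteq> 0" "B \<noteq> 0" and mu: "\<mu> \<noteq> 0" "\<mu> \<noteq> A" "\<mu> \<noteq> B"
    and on: "\<And>j. (v j $ 1)\<^sup>2 / A + (v j $ 2)\<^sup>2 / B = (v j $ 3)\<^sup>2"
    and n: "\<And>j. nform (central_gradient A B (v j)) (central_gradient A B (v j)) \<noteq> 0"
    and tangent: "\<And>j. confocal_form A B \<mu> (m j) = 0"
    and opposite: "\<And>i j. pairing (v i) (m j) = 0 \<longleftrightarrow> i \<noteq> j"
  defines "p \<equiv> (\<lambda>j :: 3. abs_cp2 (v j))"
  shows "periodic_orbit_3 (central_conic A B) p"
    "circumscribed_about p (central_conic (A - \<mu>) (B - \<mu>))"
proof -
  have v0: "v j \<noteq> 0" and m0: "m j \<noteq> 0" for j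
    using opposite[of j j] by (auto simp: pairing_3)
  have inc: "incident (p i) (abs_cp2 (m j)) \<longleftrightarrow> i \<noteq> j" for i j
    by (simp add: p_def incident_abs v0 m0 opposite)
  have ne: "p i \<noteq> p j" "abs_cp2 (m i) \<noteq> abs_cp2 (m j)" if "i \<noteq> j" for i j
    using inc that by metis+
  have join: "join (p i) (p j) = abs_cp2 (m k)" if "i \<noteq> j" "i \<noteq> k" "j \<noteq> k" for i j k
    using join_eqI[OF ne(1)] inc that by blast
  have T: "tangent_line (central_conic A B) (p j) = abs_cp2 (central_gradient A B (v j))" for j
    using tangent_line_central[OF AB v0] by (simp add: p_def)
  have arith: "j - 1 \<noteq> j" "j - 1 \<noteq> j + 1" "j \<noteq> j + 1" "j + 1 \<noteq> j - 1" "j + 1 \<noteq> j" for j :: 3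
    by simp_all
  have sides: "join (p (j - 1)) (p j) = abs_cp2 (m (j + 1))"
    "join (p j) (p (j + 1)) = abs_cp2 (m (j - 1))" for j
    using join arith by metis+
  have tangents: "{t. tangent_to t (central_conic (A - \<mu>) (B - \<mu>)) \<and> incident (p j) t} =
      {abs_cp2 (m (j + 1)), abs_cp2 (reflect_line (central_gradient A B (v j)) (m (j + 1)))}" for j
    unfolding p_def
    using tangents_through_conic_point[OF AB mu v0 on m0 _ tangent n] opposite arith by blast
  have tan: "tangent_to (abs_cp2 (m k)) (central_conic (A - \<mu>) (B - \<mu>))" for k
    using tangent_to_central[of "A - \<mu>" "B - \<mu>" "m k"] mu m0 tangent[of k]
    by (simp add: confocal_form_def)
  have refl: "abs_cp2 (reflect_line (central_gradient A B (v j)) (m (j + 1))) = abs_cp2 (m (j - 1))" for j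
  proof -
    have "abs_cp2 (m (j - 1)) \<in> {t. tangent_to t (central_conic (A - \<mu>) (B - \<mu>)) \<and> incident (p j) t}"
      using tan inc arith[of j] by auto
    then show ?thesis
      unfolding tangents using ne(2)[OF arith(2)[of j]] by auto
  qed
  show "circumscribed_about p (central_conic (A - \<mu>) (B - \<mu>))"
    unfolding circumscribed_about_def tangents refl sides by simp
  have "symmetric_lines (p j) (tangent_line (central_conic A B) (p j))
      (join (p (j - 1)) (p j)) (join (p j) (p (j + 1)))" for j
  proof -
    have "pairing (v j) (central_gradient A B (v j)) = 0"
      using on[of j] by (simp add: central_gradient_def pairing_3 power2_eq_square)
    moreover have "pairing (v j) (m (j + 1)) = 0" using opposite arith by blast
    ultimately show ?thesis
      unfolding sides T refl[symmetric] unfolding p_def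
      by (intro symmetric_lines_nonisotropic n m0 v0)
  qed
  moreover have "p j \<in> conic_points (central_conic A B)" for j
    using on central_conic_points_abs[OF AB v0] by (simp add: p_def)
  moreover have "\<not> isotropic (tangent_line (central_conic A B) (p j))" for j
    unfolding T using isotropic_nform[OF central_gradient_nonzero[OF AB v0]] n by simp
  ultimately show "periodic_orbit_3 (central_conic A B) p"
    unfolding periodic_orbit_3_def using ne(1) arith by auto
qed

text \<open>With \<open>r\<^sup>2 = (A - \<mu>) / A\<close> and \<open>R = (B - \<mu>) / B\<close>, the left-hand side of Cayley's condition is a
  non-zero multiple of \<open>(R - (1 + r)\<^sup>2) (R - (1 - r)\<^sup>2)\<close>, so that a suitable choice of
  the sign of \<open>r\<close> is the parameter \<open>s\<close>.\<close>

lemma poncelet_form_root_parameter: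
  assumes AB: "A \<noteq> 0" "B \<noteq> 0" and f: "poncelet_form A B \<mu> = (0::complex)"
  obtains s where "A * s\<^sup>2 = A - \<mu>" "B * (1 + s)\<^sup>2 = B - \<mu>"
proof -
  define r where "r = csqrt ((A - \<mu>) / A)"
  have r: "A * r\<^sup>2 = A - \<mu>" using AB by (simp add: r_def)
  define R where "R = (B - \<mu>) / B"
  have R: "B * R = B - \<mu>" using AB by (simp add: R_def)
  have "A\<^sup>2 * B\<^sup>2 * ((R - (1 + r)\<^sup>2) * (R - (1 - r)\<^sup>2)) = 0"
    using f r R unfolding poncelet_form_def by algebra
  then have "R = (1 + r)\<^sup>2 \<or> R = (1 + (- r))\<^sup>2" using AB by simp
  then show thesis
    using that[of r] that[of "- r"] r R by auto
qed

text \<open>By Poncelet's theorem a vertex may be chosen freely: take \<open>(\<surd>A, 0)\<close> on an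
  axis and the opposite side perpendicular to it. The side \<open>x = s \<surd>A\<close> is tangent exactly when
  \<open>A s\<^sup>2 = A - \<mu>\<close>, and it meets the conic where \<open>y\<^sup>2 = B (1 - s\<^sup>2)\<close>; then the other sides are tangent
  exactly when \<open>B (1 + s)\<^sup>2 = B - \<mu>\<close>.\<close>

lemma isosceles_orbit:
  assumes AB: "A \<noteq> 0" "B \<noteq> 0" and mu: "\<mu> \<noteq> 0" "\<mu> \<noteq> A" "\<mu> \<noteq> B"
    and f: "poncelet_form A B \<mu> = 0"
  shows "\<exists>p. periodic_orbit_3 (central_conic A B) p \<and>
    circumscribed_about p (central_conic (A - \<mu>) (B - \<mu>))"
proof -
  obtain s where s: "A * s\<^sup>2 = A - \<mu>" "B * (1 + s)\<^sup>2 = B - \<mu>"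
    using poncelet_form_root_parameter[OF AB f] by blast
  define x where "x = csqrt A"
  define y where "y = csqrt (B * (1 - s\<^sup>2))"
  have x: "x\<^sup>2 = A" "x \<noteq> 0" and y2: "y\<^sup>2 = B * (1 - s\<^sup>2)"
    using AB by (simp_all add: x_def y_def)
  have s0: "s \<noteq> 0" "s \<noteq> 1" "s \<noteq> -1" using s mu AB by auto
  then have "s\<^sup>2 \<noteq> 1" by (simp add: power2_eq_1_iff)
  then have y: "y \<noteq> 0" using y2 AB by auto
  define v :: "3 \<Rightarrow> complex^3" where "v j = (if j = 1 then vector [x, 0, 1]
    else if j = 2 then vector [s * x, y, 1] else vector [s * x, - y, 1])" for j
  define m :: "3 \<Rightarrow> complex^3" where "m j = (if j = 1 then vector [1, 0, - s * x]
    else if j = 2 then vector [y, (s - 1) * x, - y * x] else vector [y, (1 - s) * x, - y * x])" for j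
  have v: "v 1 = vector [x, 0, 1]" "v 2 = vector [s * x, y, 1]" "v 3 = vector [s * x, - y, 1]"
    and m: "m 1 = vector [1, 0, - s * x]" "m 2 = vector [y, (s - 1) * x, - y * x]"
      "m 3 = vector [y, (1 - s) * x, - y * x]"
    by (simp_all add: v_def m_def)
  have on: "\<forall>j. (v j $ 1)\<^sup>2 / A + (v j $ 2)\<^sup>2 / B = (v j $ 3)\<^sup>2"
    using AB by (simp add: forall_3 v x y2 power_mult_distrib)
  have iso: "s\<^sup>2 / A + (1 - s\<^sup>2) / B \<noteq> 0"
  proof
    assume "s\<^sup>2 / A + (1 - s\<^sup>2) / B = 0"
    then have "B * s\<^sup>2 + A * (1 - s\<^sup>2) = 0" using AB by (simp add: field_simps)
    then have "2 * B * s = 0" using s by algebra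
    then show False using AB s0 by simp
  qed
  have "(s * x / A)\<^sup>2 + (y / B)\<^sup>2 = s\<^sup>2 / A + (1 - s\<^sup>2) / B"
    using AB x(1) y2 by (simp add: power_divide power_mult_distrib) (simp add: power2_eq_square)
  then have n: "\<forall>j. nform (central_gradient A B (v j)) (central_gradient A B (v j)) \<noteq> 0"
    using iso AB x by (simp add: forall_3 v nform_def central_gradient_def power2_eq_square)
  have "confocal_form A B \<mu> (vector [y, c * x, - y * x]) = 0" if "c\<^sup>2 = (1 - s)\<^sup>2" for c
  proof -
    have "confocal_form A B \<mu> (vector [y, c * x, - y * x]) = A * s\<^sup>2 * y\<^sup>2 + B * (1 + s)\<^sup>2 * ((1 - s)\<^sup>2 * A) - y\<^sup>2 * A"
      by (simp add: confocal_form_def s[symmetric] power_mult_distrib that x(1))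
    also have "\<dots> = A * (s\<^sup>2 - 1) * (y\<^sup>2 - B * (1 - s\<^sup>2))"
      by (simp add: power2_eq_square algebra_simps)
    finally show ?thesis by (simp add: y2)
  qed
  moreover have "(s - 1)\<^sup>2 = (1 - s)\<^sup>2" by (rule power2_commute)
  moreover have "confocal_form A B \<mu> (vector [1, 0, - s * x]) = 0"
    using s(1) x(1) by (simp add: confocal_form_def power_mult_distrib mult.commute)
  ultimately have tangent: "\<forall>j. confocal_form A B \<mu> (m j) = 0"
    by (simp add: forall_3 m)
  have opposite: "\<forall>i j. pairing (v i) (m j) = 0 \<longleftrightarrow> i \<noteq> j"
    using x y s0 by (simp add: forall_3 v m pairing_3 algebra_simps)
  show ?thesis
    using tangent_triangle_orbit[OF AB mu, of v m] on n tangent opposite by blast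
qed

lemma confocal_caustic_3_iff:
  assumes AB: "A \<noteq> 0" "B \<noteq> 0" "A \<noteq> B" and mu: "\<mu> \<noteq> A" "\<mu> \<noteq> B"
  shows "caustic_3 (central_conic A B) (central_conic (A - \<mu>) (B - \<mu>)) \<longleftrightarrow> poncelet_form A B \<mu> = 0"
proof
  assume "caustic_3 (central_conic A B) (central_conic (A - \<mu>) (B - \<mu>))"
  then show "poncelet_form A B \<mu> = 0"
    using circumscribed_orbit_condition[OF AB(1,2) mu] by (auto simp: caustic_3_def)
next
  assume f: "poncelet_form A B \<mu> = 0"
  then have "\<mu> \<noteq> 0" using AB by (auto simp: poncelet_form_def)
  then show "caustic_3 (central_conic A B) (central_conic (A - \<mu>) (B - \<mu>))"
    using confocal_general_position[OF AB _ mu] confocal_complex_caustic[OF AB mu]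
      isosceles_orbit[OF AB(1,2) _ mu f] by (simp add: caustic_3_def)
qed

section \<open>Ellipses, hyperbolas and the two roots\<close>

lemma conic_rel_refl: "conic_rel M M \<longleftrightarrow> transpose M = M \<and> det M \<noteq> 0"
  by (auto simp: conic_rel_def intro: exI[of _ 1])

lemma abs_conic_eq_iff:
  assumes "conic_rel M M" "conic_rel N N"
  shows "abs_conic M = abs_conic N \<longleftrightarrow> (\<exists>c. c \<noteq> 0 \<and> (\<forall>i j. N $ i $ j = c * M $ i $ j))"
proof -
  have "conic_rel M N \<longleftrightarrow> abs_conic M = abs_conic N"
    using Quotient_rel[OF Quotient_conic, of M N] assms by simp
  then show ?thesis using assms by (auto simp: conic_rel_def)
qed

lemma central_conic_inject:
  assumes "A \<noteq> 0" "B \<noteq> 0" "A' \<noteq> 0" "B' \<noteq> 0" "central_conic A B = central_conic A' B'"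
  shows "A = A'"
  using assms abs_conic_eq_iff[OF conic_rel_central[OF assms(1,2)] conic_rel_central[OF assms(3,4)]]
  by (auto simp: central_conic_def forall_3)

definition real_central_matrix :: "real \<Rightarrow> real \<Rightarrow> real^3^3" where
  "real_central_matrix A B = vector [vector [1 / A, 0, 0], vector [0, 1 / B, 0], vector [0, 0, -1]]"

lemma real_central_matrix:
  assumes "A \<noteq> 0" "B \<noteq> 0"
  shows "transpose (real_central_matrix A B) = real_central_matrix A B"
    "det (real_central_matrix A B) \<noteq> 0"
    "complexification (real_central_matrix A B) = central_conic (of_real A) (of_real B)"
    "real_conic_points (real_central_matrix A B) = {P. (P$1)\<^sup>2 / A + (P$2)\<^sup>2 / B = 1}"
proof -
  show "transpose (real_central_matrix A B) = real_central_matrix A B"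
    by (simp add: real_central_matrix_def transpose_def vec_eq_iff forall_3)
  show "det (real_central_matrix A B) \<noteq> 0"
    using assms by (simp add: real_central_matrix_def det_3)
  have "(\<chi> i j. complex_of_real (real_central_matrix A B $ i $ j)) =
      vector [vector [1 / of_real A, 0, 0], vector [0, 1 / of_real B, 0], vector [0, 0, -1]]"
    by (simp add: real_central_matrix_def vec_eq_iff forall_3)
  then show "complexification (real_central_matrix A B) = central_conic (of_real A) (of_real B)"
    by (simp add: complexification_def central_conic_def)
  show "real_conic_points (real_central_matrix A B) = {P. (P$1)\<^sup>2 / A + (P$2)\<^sup>2 / B = 1}"
    by (auto simp: real_conic_points_def real_central_matrix_def Let_def inner_vec_def sum_3
        matrix_vector_mult_def power2_eq_square)
qed

lemma axis_frame:
  "norm (axis 1 1 :: real^2) = 1" "norm (axis 2 1 :: real^2) = 1" "(axis 1 1 :: real^2) \<bullet> axis 2 1 = 0"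
  by (simp_all add: norm_eq_sqrt_inner inner_axis_axis)

lemma complexified_ellipse_central:
  assumes "A > 0" "B > 0"
  shows "complexified_ellipse (central_conic (of_real A) (of_real B))"
proof -
  have "is_ellipse {P :: real^2. (P$1)\<^sup>2 / A + (P$2)\<^sup>2 / B = 1}"
    unfolding is_ellipse_def
    using assms axis_frame
    by (intro exI[of _ 0] exI[of _ "axis 1 1"] exI[of _ "axis 2 1"] exI[of _ "sqrt A"] exI[of _ "sqrt B"])
       (simp add: inner_axis)
  then show ?thesis
    unfolding complexified_ellipse_def using real_central_matrix[of A B] assms
    by (intro exI[of _ "real_central_matrix A B"]) simp
qed

lemma complexified_hyperbola_central:
  assumes "A > 0" "B < 0"
  shows "complexified_hyperbola (central_conic (of_real A) (of_real B))"
proof -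
  have "is_hyperbola {P :: real^2. (P$1)\<^sup>2 / A + (P$2)\<^sup>2 / B = 1}"
    unfolding is_hyperbola_def
    using assms axis_frame
    by (intro exI[of _ 0] exI[of _ "axis 1 1"] exI[of _ "axis 2 1"] exI[of _ "sqrt A"] exI[of _ "sqrt (- B)"])
       (simp add: inner_axis)
  then show ?thesis
    unfolding complexified_hyperbola_def using real_central_matrix[of A B] assms
    by (intro exI[of _ "real_central_matrix A B"]) simp
qed

lemma orthonormal_frame_expansion:
  fixes u v x :: "real^2"
  assumes "norm u = 1" "norm v = 1" "u \<bullet> v = 0"
  shows "(norm x)\<^sup>2 = (x \<bullet> u)\<^sup>2 + (x \<bullet> v)\<^sup>2"
proof -
  have 1: "(u$1)\<^sup>2 + (u$2)\<^sup>2 = 1" "(v$1)\<^sup>2 + (v$2)\<^sup>2 = 1" "u$1 * v$1 + u$2 * v$2 = 0"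
    using assms by (simp_all add: norm_eq_1 inner_vec_def sum_2 power2_eq_square)
  have "(x$1)\<^sup>2 + (x$2)\<^sup>2 = (x$1 * u$1 + x$2 * u$2)\<^sup>2 + (x$1 * v$1 + x$2 * v$2)\<^sup>2"
    using 1 by algebra
  then show ?thesis
    unfolding power2_norm_eq_inner inner_vec_def sum_2 by (simp add: power2_eq_square)
qed

lemma bounded_ellipse:
  assumes "is_ellipse S"
  shows "bounded S"
proof -
  obtain c u v \<alpha> \<beta> where e: "norm u = 1" "norm v = 1" "u \<bullet> v = 0" "\<alpha> > 0" "\<beta> > 0"
      "S = {P. ((P - c) \<bullet> u)\<^sup>2 / \<alpha>\<^sup>2 + ((P - c) \<bullet> v)\<^sup>2 / \<beta>\<^sup>2 = 1}"
    using assms by (auto simp: is_ellipse_def)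
  have "dist c P \<le> sqrt (\<alpha>\<^sup>2 + \<beta>\<^sup>2)" if "P \<in> S" for P
  proof -
    have eq: "((P - c) \<bullet> u)\<^sup>2 / \<alpha>\<^sup>2 + ((P - c) \<bullet> v)\<^sup>2 / \<beta>\<^sup>2 = 1" using that e by simp
    then have "((P - c) \<bullet> u)\<^sup>2 / \<alpha>\<^sup>2 \<le> 1" "((P - c) \<bullet> v)\<^sup>2 / \<beta>\<^sup>2 \<le> 1"
      by (smt (verit) zero_le_divide_iff zero_le_power2)+
    then have "((P - c) \<bullet> u)\<^sup>2 \<le> \<alpha>\<^sup>2" "((P - c) \<bullet> v)\<^sup>2 \<le> \<beta>\<^sup>2"
      using e by (simp_all add: divide_le_eq_1)
    then have "(norm (P - c))\<^sup>2 \<le> \<alpha>\<^sup>2 + \<beta>\<^sup>2"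
      using orthonormal_frame_expansion[OF e(1-3)] by simp
    then show ?thesis by (simp add: dist_norm norm_minus_commute real_le_rsqrt)
  qed
  then show ?thesis unfolding bounded_def by blast
qed

lemma unbounded_hyperbola:
  assumes "is_hyperbola S"
  shows "\<not> bounded S"
proof
  assume "bounded S"
  obtain c u v \<alpha> \<beta> where e: "norm u = 1" "norm v = 1" "u \<bullet> v = 0" "\<alpha> > 0" "\<beta> > 0"
      "S = {P. ((P - c) \<bullet> u)\<^sup>2 / \<alpha>\<^sup>2 - ((P - c) \<bullet> v)\<^sup>2 / \<beta>\<^sup>2 = 1}"
    using assms by (auto simp: is_hyperbola_def)
  obtain r where r: "\<And>P. P \<in> S \<Longrightarrow> dist c P \<le> r"
    using \<open>bounded S\<close> unfolding bounded_any_center[of S c] by blast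
  define t where "t = (\<bar>r\<bar> + 1) / \<beta>"
  define P where "P = c + (\<alpha> * sqrt (1 + t\<^sup>2)) *\<^sub>R u + (\<beta> * t) *\<^sub>R v"
  have uv: "u \<bullet> u = 1" "v \<bullet> v = 1" "v \<bullet> u = 0"
    using e by (simp_all add: norm_eq_1 inner_commute)
  have P: "(P - c) \<bullet> u = \<alpha> * sqrt (1 + t\<^sup>2)" "(P - c) \<bullet> v = \<beta> * t"
    using uv e(3) by (simp_all add: P_def inner_add_left)
  have "P \<in> S"
    using e(4,5) unfolding e(6) mem_Collect_eq P by (simp add: power_mult_distrib)
  then have "norm (P - c) \<le> r" using r[of P] by (simp add: dist_norm norm_minus_commute)
  moreover have "(P - c) \<bullet> v \<le> norm (P - c)"
    using norm_cauchy_schwarz[of "P - c" v] e(2) by simp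
  ultimately show False using e(5) unfolding P by (simp add: t_def)
qed

text \<open>Two real representatives of a conic differ by a complex factor, which is real since both matrices
  are real and non-zero.\<close>

lemma complexification_inject:
  assumes "transpose R = R" "det R \<noteq> 0" "transpose R' = R'" "det R' \<noteq> 0"
    and eq: "complexification R = complexification R'"
  shows "real_conic_points R = real_conic_points R'"
proof -
  define X where "X R = (\<chi> i j. complex_of_real (R $ i $ j))" for R :: "real^3^3"
  have rel: "conic_rel (X R) (X R)" if "transpose R = R" "det R \<noteq> 0" for R
  proof -
    have "transpose (X R) = X R"
      using symmetric_matrix_entry[OF that(1)] by (simp add: X_def transpose_def vec_eq_iff)
    moreover have "det (X R) = of_real (det R)" by (simp add: X_def det_3)
    ultimately show ?thesis using that(2) by (simp add: conic_rel_refl)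
  qed
  obtain c where c: "c \<noteq> 0" "\<forall>i j. X R' $ i $ j = c * X R $ i $ j"
    using eq abs_conic_eq_iff[OF rel[OF assms(1,2)] rel[OF assms(3,4)]]
    by (auto simp: complexification_def X_def)
  have re: "R' $ i $ j = Re c * R $ i $ j" "Im c * R $ i $ j = 0" for i j
    using arg_cong[OF c(2)[rule_format, of i j], of Re] arg_cong[OF c(2)[rule_format, of i j], of Im]
    by (simp_all add: X_def)
  have "\<not> (\<forall>i j. R $ i $ j = 0)"
  proof
    assume "\<forall>i j. R $ i $ j = 0"
    then have "det R = 0" by (simp add: det_3)
    then show False using assms(2) by contradiction
  qed
  then have "Im c = 0" using re(2) by auto
  then have "Re c \<noteq> 0" using c(1) by (simp add: complex_eq_iff)
  moreover have "v \<bullet> (R' *v v) = Re c * (v \<bullet> (R *v v))" for v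
    by (simp add: inner_vec_def matrix_vector_mult_def re(1) sum_3 algebra_simps)
  ultimately show ?thesis by (simp add: real_conic_points_def Let_def)
qed

lemma not_ellipse_and_hyperbola:
  assumes "complexified_ellipse C" "complexified_hyperbola C"
  shows False
  using assms complexification_inject bounded_ellipse unbounded_hyperbola
  unfolding complexified_ellipse_def complexified_hyperbola_def by metis

text \<open>The quarter discriminant is \<open>4 a\<^sup>2 b\<^sup>2 (a\<^sup>2 - a b + b\<^sup>2) > 0\<close>, and the product of the roots is
  negative.\<close>

lemma poncelet_form_roots:
  fixes a b :: real
  assumes "a \<noteq> 0" "b \<noteq> 0" "a \<noteq> b"
  obtains r s where "r < 0" "0 < s"
    "\<And>z :: complex. poncelet_form (of_real a) (of_real b) z =
      (of_real a - of_real b)\<^sup>2 * (z - of_real r) * (z - of_real s)"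
proof -
  define d where "d = (a - b)\<^sup>2"
  define w where "w = sqrt (a\<^sup>2 - a * b + b\<^sup>2)"
  define r1 where "r1 = a * b * (- (a + b) - 2 * w) / d"
  define r2 where "r2 = a * b * (- (a + b) + 2 * w) / d"
  have d: "d > 0" using assms by (simp add: d_def)
  have "a\<^sup>2 - a * b + b\<^sup>2 = (a + b)\<^sup>2 / 4 + 3 * (a - b)\<^sup>2 / 4"
    by (simp add: power2_eq_square field_simps)
  then have "a\<^sup>2 - a * b + b\<^sup>2 \<ge> 0" by simp
  then have w: "w\<^sup>2 = a\<^sup>2 - a * b + b\<^sup>2" by (simp add: w_def)
  have dr: "d * r1 = a * b * (- (a + b) - 2 * w)" "d * r2 = a * b * (- (a + b) + 2 * w)"
    using d by (simp_all add: r1_def r2_def)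
  have "d * (r1 + r2) + 2 * a * b * (a + b) = 0" using dr by algebra
  moreover have "d * (d * (r1 * r2) + 3 * a\<^sup>2 * b\<^sup>2) = 0"
    using dr w d_def by algebra
  ultimately have vieta: "d * (r1 + r2) = - (2 * a * b * (a + b))" "d * (r1 * r2) = - (3 * a\<^sup>2 * b\<^sup>2)"
    using d by simp_all
  have fact: "poncelet_form (of_real a) (of_real b) z =
      (of_real a - of_real b)\<^sup>2 * (z - of_real r1) * (z - of_real r2)" for z :: complex
  proof -
    have "complex_of_real (d * (r1 + r2)) = of_real (- (2 * a * b * (a + b)))"
      "complex_of_real (d * (r1 * r2)) = of_real (- (3 * a\<^sup>2 * b\<^sup>2))"
      "complex_of_real d = (of_real a - of_real b)\<^sup>2"
      by (simp_all only: vieta) (simp add: d_def)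
    then show ?thesis
      unfolding poncelet_form_def of_real_mult of_real_add of_real_minus of_real_power of_real_numeral
      by algebra
  qed
  have "d * (r1 * r2) < 0" unfolding vieta using assms by simp
  then have "r1 * r2 < 0" using d by (simp add: mult_less_0_iff)
  then consider "r1 < 0" "0 < r2" | "r2 < 0" "0 < r1" by (auto simp: mult_less_0_iff)
  then show thesis
  proof cases
    case 1
    then show thesis using that[of r1 r2] fact by blast
  next
    case 2
    have "poncelet_form (of_real a) (of_real b) z =
      (of_real a - of_real b)\<^sup>2 * (z - of_real r2) * (z - of_real r1)" for z :: complex
      by (simp add: fact ac_simps)
    with 2 show thesis using that[of r2 r1] by blast
  qed
qed

text \<open>The quadratic polynomial takes the values \<open>a\<^sup>4\<close> and \<open>b\<^sup>4\<close> at \<open>a\<close> and \<open>b\<close>. Hence neither root is one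
  of the excluded parameters, and neither \<open>a\<close> nor \<open>b\<close> lies between the roots. As \<open>0\<close> does, \<open>a - \<mu>\<close>
  and \<open>b - \<mu>\<close> have the signs of \<open>a\<close> and \<open>b\<close> for both roots \<open>\<mu>\<close>, which fixes the type of the caustics.\<close>

lemma confocal_3_caustics_eq:
  fixes a b :: real
  assumes ab: "a \<noteq> 0" "b \<noteq> 0" "a \<noteq> b"
  obtains r s where "r < 0" "0 < s" "0 < (a - r) * (a - s)" "0 < (b - r) * (b - s)"
    "confocal_3_caustics a b = {confocal_conic a b (of_real r), confocal_conic a b (of_real s)}"
proof -
  obtain r s where rs: "r < 0" "0 < s" and f: "\<And>z :: complex. poncelet_form (of_real a) (of_real b) z =
      (of_real a - of_real b)\<^sup>2 * (z - of_real r) * (z - of_real s)"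
    using poncelet_form_roots[OF ab] by blast
  have real_form: "(a - b)\<^sup>2 * ((x - r) * (x - s)) = poncelet_form a b x" for x
  proof -
    have "complex_of_real ((a - b)\<^sup>2 * ((x - r) * (x - s))) = of_real (poncelet_form a b x)"
      using f[of "of_real x"] by (simp add: poncelet_form_def mult.assoc)
    then show ?thesis by (simp only: of_real_eq_iff)
  qed
  have "poncelet_form a b a = a ^ 4" "poncelet_form a b b = b ^ 4"
    unfolding poncelet_form_def by algebra+
  then have "(a - b)\<^sup>2 * ((a - r) * (a - s)) > 0" "(a - b)\<^sup>2 * ((b - r) * (b - s)) > 0"
    unfolding real_form using ab by simp_all
  then have pos: "0 < (a - r) * (a - s)" "0 < (b - r) * (b - s)"
    by (simp_all add: zero_less_mult_iff[of "(a - b)\<^sup>2"])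
  have roots: "poncelet_form (of_real a) (of_real b) z = 0 \<longleftrightarrow> z = of_real r \<or> z = of_real s" for z :: complex
    using ab by (simp add: f)
  have "z \<notin> {of_real a, of_real b} \<and> caustic_3 (central_conic (of_real a) (of_real b)) (confocal_conic a b z)
      \<longleftrightarrow> z = of_real r \<or> z = of_real s" for z
  proof -
    have "z \<notin> {of_real a, of_real b}" if "z = of_real r \<or> z = of_real s"
      using that pos by auto
    then show ?thesis
      using confocal_caustic_3_iff[of "of_real a" "of_real b" z] ab roots[of z]
      by (auto simp: confocal_conic_def)
  qed
  then have "confocal_3_caustics a b = {confocal_conic a b (of_real r), confocal_conic a b (of_real s)}"
    unfolding confocal_3_caustics_def by auto
  with rs pos show thesis by (rule that)
qed

theorem proposition2p27:
  fixes a b :: real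
  assumes "a \<noteq> 0" and "b \<noteq> 0" and "a \<noteq> b"
    and "(a > 0 \<and> b > 0) \<or> (a > 0 \<and> 0 > b)"
  shows "(a > 0 \<and> b > 0 \<longrightarrow> complexified_ellipse (central_conic (of_real a) (of_real b)))
    \<and> (a > 0 \<and> 0 > b \<longrightarrow> complexified_hyperbola (central_conic (of_real a) (of_real b)))
    \<and> card (confocal_3_caustics a b) = 2
    \<and> (complexified_ellipse (central_conic (of_real a) (of_real b)) \<longrightarrow>
         (\<forall>C \<in> confocal_3_caustics a b. complexified_ellipse C))
    \<and> (complexified_hyperbola (central_conic (of_real a) (of_real b)) \<longrightarrow>
         (\<forall>C \<in> confocal_3_caustics a b. complexified_hyperbola C))"
proof -
  obtain r s where rs: "r < 0" "0 < s" and pos: "0 < (a - r) * (a - s)" "0 < (b - r) * (b - s)"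
    and caustics: "confocal_3_caustics a b = {confocal_conic a b (of_real r), confocal_conic a b (of_real s)}"
    using confocal_3_caustics_eq[OF assms(1-3)] by metis
  have confocal: "confocal_conic a b (of_real x) = central_conic (of_real (a - x)) (of_real (b - x))" for x
    by (simp add: confocal_conic_def)
  have a: "a > 0" using assms(4) by auto
  have a': "a - r > 0" "a - s > 0" using pos(1) rs a by (auto simp: zero_less_mult_iff)
  have "confocal_conic a b (of_real r) \<noteq> confocal_conic a b (of_real s)"
  proof
    assume "confocal_conic a b (of_real r) = confocal_conic a b (of_real s)"
    then have "complex_of_real (a - r) = of_real (a - s)"
      unfolding confocal using pos by (intro central_conic_inject) auto
    then show False using rs by (simp only: of_real_eq_iff)
  qed
  then have two: "card (confocal_3_caustics a b) = 2" by (simp add: caustics)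
  show ?thesis
  proof (cases "b > 0")
    case True
    then have "b - r > 0" "b - s > 0" using pos(2) rs by (auto simp: zero_less_mult_iff)
    then have "\<forall>C \<in> confocal_3_caustics a b. complexified_ellipse C"
      using a' complexified_ellipse_central by (simp add: caustics confocal del: of_real_diff)
    moreover have "complexified_ellipse (central_conic (of_real a) (of_real b))"
      by (rule complexified_ellipse_central[OF a True])
    ultimately show ?thesis using True two not_ellipse_and_hyperbola by auto
  next
    case False
    then have b: "b < 0" using assms(4) by auto
    then have "b - r < 0" "b - s < 0" using pos(2) rs by (auto simp: zero_less_mult_iff)
    then have "\<forall>C \<in> confocal_3_caustics a b. complexified_hyperbola C"
      using a' complexified_hyperbola_central by (simp add: caustics confocal del: of_real_diff)
    moreover have "complexified_hyperbola (central_conic (of_real a) (of_real b))"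
      by (rule complexified_hyperbola_central[OF a b])
    ultimately show ?thesis using False two not_ellipse_and_hyperbola by auto
  qed
qed

end
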